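(* Let $n\ge 2$ and $k\ge 0$ be integers, and let $g_{n,k}:=|\{\beta\in B_n:\|\beta\|_d=2k+n-1\}|$. Then $$g_{n,k}\ge\binom{k+n-2}{n-2}.$$
   Context: Let $D^2\subseteq\mathbb{C}$ be the closed unit disk, let $p_1<\dots<p_n$ be points of $(-1,1)$ (the punctures), and let $P_n=\{p_1,\dots,p_n\}$. Let $H_n$ be the group of orientation-preserving homeomorphisms $h:\mathbb{C}\to\mathbb{C}$ such that $h(P_n)=P_n$, $h(\partial D^2)=\partial D^2$, $h(1)=1$ and $h(-1)=-1$. The braid group $B_n$ is the quotient of $H_n$ by the isotopy relation (isotopy through elements of $H_n$). The trivial lamination $\mathbf{L}$ is the union of the vertical lines $\frac12(p_j+p_{j+1})+i\mathbb{R}$, $1\le j\le n-1$. The diagrammatic norm of $\beta\in B_n$ is $\|\beta\|_d:=\min\{|h([-1,1])\cap\mathbf{L}| : h\in H_n \text{ represents }\beta\}$. *)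

theory Defs
  imports "HOL-Complex_Analysis.Complex_Analysis" "HOL-Library.Extended_Nat"
begin

text \<open>The closed unit disk is \<open>cball 0 1\<close>, its boundary circle is \<open>sphere 0 1\<close>, and the segment
  \<open>[-1, 1]\<close> is \<open>closed_segment (-1) 1\<close>. The punctures are given by a function \<open>p\<close> on the
  indices \<open>1, \<dots>, n\<close>; its values at other indices are never used.\<close>

definition puncture_config :: "nat \<Rightarrow> (nat \<Rightarrow> real) \<Rightarrow> bool" where
  "puncture_config n p \<longleftrightarrow> strict_mono_on {1..n} p \<and> p ` {1..n} \<subseteq> {-1<..<1}"

definition puncture_set :: "nat \<Rightarrow> (nat \<Rightarrow> real) \<Rightarrow> complex set" where
  "puncture_set n p = (\<lambda>j. complex_of_real (p j)) ` {1..n}"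

text \<open>A homeomorphism of the plane preserves orientation if its local degree at every point is 1,
  i.e. the image of each positively oriented circle around \<open>z\<close> winds once, positively,
  around \<open>h z\<close>.\<close>

definition orientation_preserving_homeo :: "(complex \<Rightarrow> complex) \<Rightarrow> bool" where
  "orientation_preserving_homeo h \<longleftrightarrow>
     (\<exists>h'. homeomorphism UNIV UNIV h h') \<and>
     (\<forall>z r. 0 < r \<longrightarrow> winding_number (h \<circ> circlepath z r) (h z) = 1)"

definition H_homeos :: "nat \<Rightarrow> (nat \<Rightarrow> real) \<Rightarrow> (complex \<Rightarrow> complex) set" where
  "H_homeos n p =
     {h. orientation_preserving_homeo h \<and>
         h ` puncture_set n p = puncture_set n p \<and>
         h ` sphere 0 1 = sphere 0 1 \<and> h 1 = 1 \<and> h (-1) = -1}"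

definition isotopy_rel :: "nat \<Rightarrow> (nat \<Rightarrow> real) \<Rightarrow> ((complex \<Rightarrow> complex) \<times> (complex \<Rightarrow> complex)) set" where
  "isotopy_rel n p =
     {(h, h'). homotopic_with_canon (\<lambda>f. f \<in> H_homeos n p) UNIV UNIV h h'}"

lemma equiv_isotopy_rel: "equiv (H_homeos n p) (isotopy_rel n p)"
proof (rule equivI)
  show "isotopy_rel n p \<subseteq> H_homeos n p \<times> H_homeos n p"
    unfolding isotopy_rel_def using homotopic_with_imp_property by blast
  have "continuous_on UNIV h" if "h \<in> H_homeos n p" for h
    using that unfolding H_homeos_def orientation_preserving_homeo_def
    by (blast dest: homeomorphism_cont1)
  then show "refl_on (H_homeos n p) (isotopy_rel n p)"
    by (simp add: refl_on_def isotopy_rel_def)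
  show "sym (isotopy_rel n p)"
    unfolding sym_def isotopy_rel_def by (blast intro: homotopic_with_symD)
  show "trans (isotopy_rel n p)"
    unfolding trans_def isotopy_rel_def by (blast intro: homotopic_with_trans)
qed

text \<open>Only the underlying set of the braid group is introduced: a braid is an isotopy class,
  i.e. the set of all homeomorphisms representing it.\<close>

definition braids :: "nat \<Rightarrow> (nat \<Rightarrow> real) \<Rightarrow> (complex \<Rightarrow> complex) set set" where
  "braids n p = H_homeos n p // isotopy_rel n p"

definition trivial_lamination :: "nat \<Rightarrow> (nat \<Rightarrow> real) \<Rightarrow> complex set" where
  "trivial_lamination n p = (\<Union>j\<in>{1..n-1}. {z. Re z = (p j + p (j + 1)) / 2})"

text \<open>Cardinality with value \<open>\<infinity>\<close> on infinite sets, where \<open>card\<close> would be 0: a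
  representative may meet the lamination in infinitely many points.\<close>

definition ecard :: "'a set \<Rightarrow> enat" where
  "ecard A = (if finite A then enat (card A) else \<infinity>)"

text \<open>The infimum of a nonempty set of extended naturals is attained, so for a braid \<open>\<beta>\<close> this is
  the minimum over its representatives.\<close>

definition diagrammatic_norm :: "nat \<Rightarrow> (nat \<Rightarrow> real) \<Rightarrow> (complex \<Rightarrow> complex) set \<Rightarrow> enat" where
  "diagrammatic_norm n p \<beta> =
     (INF h\<in>\<beta>. ecard (h ` closed_segment (-1) 1 \<inter> trivial_lamination n p))"

definition g_count :: "nat \<Rightarrow> (nat \<Rightarrow> real) \<Rightarrow> nat \<Rightarrow> enat" where
  "g_count n p k = ecard {\<beta> \<in> braids n p. diagrammatic_norm n p \<beta> = enat (2 * k + n - 1)}"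

end

theory Submission
  imports Defs
begin

text \<open>For every tuple \<open>(k\<^sub>1, \<dots>, k\<^sub>n\<^sub>-\<^sub>1)\<close> of naturals with sum \<open>k\<close> there is a braid whose curve
  diagram meets the line between the \<open>j\<close>-th and the \<open>(j + 1)\<close>-st puncture exactly \<open>2 k\<^sub>j + 1\<close> times;
  there are \<open>(k + n - 2) choose (n - 2)\<close> such tuples. The braid is a product of half twists of nested
  or disjoint disks, one for each connected component of each superlevel set
  \<open>{j. k\<^sub>j \<ge> t}\<close>, \<open>t \<ge> 1\<close>. If all strands are forgotten except the two that end at the punctures
  \<open>p\<^sub>j\<close> and \<open>p\<^sub>j\<^sub>+\<^sub>1\<close>, it becomes the \<open>k\<^sub>j\<close>-th power of the generator of the
  two-strand braid group. This power is an isotopy invariant, given by winding numbers, so distinct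
  tuples give distinct braids; and it forces at least \<open>2 k\<^sub>j + 1\<close> crossings with the line,
  because each excursion of a simple arc beyond the line can be closed up on the near side to a
  Jordan curve, whose winding number is at most 1.\<close>

section \<open>Winding numbers and crossings of simple arcs\<close>

text \<open>A representative is an arbitrary homeomorphism, so its diagram may be a wild arc that
  touches a line without crossing it. The lower bound is therefore derived from continuity and
  injectivity alone, without any reduction to a position free of bigons. The two strands of a pair
  cut the diagram at parameters \<open>s < t\<close> into three arcs. The arc from -1 to
  \<open>h s\<close> makes k_j / 2 turns about \<open>h t\<close>, the arc from 1 to
  \<open>h t\<close> makes k_j / 2 turns about \<open>h s\<close>. Each of them must meet the line
  k_j times, and the middle arc joins its two sides: hence 2 k_j + 1. In the construction all half
  twists have the same sign, so turns never cancel: a half twist of a disk containing both punctures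
  lengthens either end arc by a piece that makes half a turn and meets a vertical line at most once.
  The obstacle there is that a geometric half twist reflects its disk and need not preserve an
  unevenly spaced puncture set. So it is first only required that the punctures are images of some
  points of the diameter; a final correction along the diameter moves the punctures to these
  points.\<close>

text \<open>The path avoids the ray from \<open>w\<close> in direction \<open>- 1 / c\<close>, so a
  principal logarithm, rotated by \<open>c\<close>, is a continuous logarithm of
  \<open>g - w\<close> along the whole path.\<close>

lemma Re_winding_number_slit:
  assumes "path g" "c \<noteq> 0" "\<And>t. t \<in> {0..1} \<Longrightarrow> (g t - w) * c \<notin> \<real>\<^sub>\<le>\<^sub>0"
  shows "Re (winding_number g w) = (Arg ((g 1 - w) * c) - Arg ((g 0 - w) * c)) / (2 * pi)"
proof -
  define l where "l t = Ln ((g t - w) * c) - Ln c" for t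
  have "continuous_on {0..1} g"
    using assms(1) by (simp add: path_def)
  then have "path l"
    unfolding l_def path_def by (intro continuous_intros assms(3))
  have nz: "(g t - w) * c \<noteq> 0" if "t \<in> {0..1}" for t
    using assms(3)[OF that] by auto
  have ex: "exp (l t) = g t - w" if "t \<in> {0..1}" for t
    using nz[OF that] assms(2) by (simp add: l_def exp_diff)
  have "winding_number g w = winding_number (\<lambda>t. g t - w) 0"
    by (rule winding_number_offset)
  also have "\<dots> = winding_number (exp \<circ> l) 0"
    by (rule winding_number_cong) (simp add: ex)
  also have "\<dots> = (l 1 - l 0) / (2 * of_real pi * \<i>)"
    using winding_number_compose_exp[OF \<open>path l\<close>] by (simp add: pathstart_def pathfinish_def)
  also have "Re \<dots> = (Im (l 1) - Im (l 0)) / (2 * pi)"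
    by (simp add: Re_divide power2_eq_square field_simps)
  finally show ?thesis
    using nz[of 0] nz[of 1] by (simp add: l_def Arg_eq_Im_Ln)
qed


section \<open>Excursions of a real function and its zeros\<close>

text \<open>\<open>r\<close> is the supremum of the times in \<open>[0, x]\<close> at which
  \<open>v\<close> is negative. The last conclusion, that such times accumulate at \<open>r\<close>
  from the left, excludes a mere touching of zero and later yields a negative time with no zero
  between it and \<open>r\<close>.\<close>

lemma last_sign_change:
  fixes v :: "real \<Rightarrow> real"
  assumes cont: "continuous_on {0..x} v" and "v x > 0" "v a < 0" "0 \<le> a" "a \<le> x"
  obtains r where "a \<le> r" "r < x" "v r = 0" "\<And>\<tau>. \<tau> \<in> {r..x} \<Longrightarrow> v \<tau> \<ge> 0"
    "\<And>e. e < r \<Longrightarrow> \<exists>\<tau>\<in>{0..<r}. e < \<tau> \<and> v \<tau> < 0"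
proof
  define R where "R = {\<tau>\<in>{0..x}. v \<tau> < 0}"
  define r where "r = Sup R"
  have near: "\<exists>e>0. \<forall>z\<in>{0..x}. \<bar>z - y\<bar> < e \<longrightarrow> \<bar>v z - v y\<bar> < d" if "y \<in> {0..x}" "d > 0" for y d
    using cont that unfolding continuous_on_iff dist_real_def by blast
  have "a \<in> R" using assms by (simp add: R_def)
  then have R: "R \<noteq> {}" "bdd_above R"
    by (auto simp: R_def intro: bdd_aboveI[of _ x])
  have Rle: "\<tau> \<le> r" if "\<tau> \<in> R" for \<tau>
    using R that by (auto simp: r_def intro: cSup_upper)
  show "a \<le> r" using \<open>a \<in> R\<close> by (rule Rle)
  have "r \<le> x" unfolding r_def using R by (auto intro: cSup_least simp: R_def)
  then have r: "r \<in> {0..x}" using \<open>a \<le> r\<close> assms by auto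
  have ge: "\<not> v r > 0"
  proof
    assume "v r > 0"
    then obtain e where e: "e > 0" "\<And>y. y \<in> {0..x} \<Longrightarrow> \<bar>y - r\<bar> < e \<Longrightarrow> \<bar>v y - v r\<bar> < v r"
      using near[OF r, of "v r"] by auto
    obtain \<tau> where "\<tau> \<in> R" "\<tau> > r - e"
      using less_cSupD[OF R(1), of "r - e"] \<open>e > 0\<close> by (auto simp: r_def)
    then show False
      using e(2)[of \<tau>] Rle[of \<tau>] by (auto simp: R_def)
  qed
  then show "r < x" using \<open>r \<le> x\<close> assms by (cases "r = x") auto
  have "\<not> v r < 0"
  proof
    assume *: "v r < 0"
    then obtain e where e: "e > 0" "\<And>y. y \<in> {0..x} \<Longrightarrow> \<bar>y - r\<bar> < e \<Longrightarrow> \<bar>v y - v r\<bar> < - v r"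
      using near[OF r, of "- v r"] by auto
    define y where "y = min x (r + e / 2)"
    have "y > r" "\<bar>y - r\<bar> < e" "y \<in> {0..x}"
      using e \<open>r < x\<close> r by (auto simp: y_def min_def)
    then show False
      using e(2)[of y] Rle[of y] \<open>v r < 0\<close> by (auto simp: R_def abs_less_iff)
  qed
  with ge show v0: "v r = 0" by simp
  show "v \<tau> \<ge> 0" if "\<tau> \<in> {r..x}" for \<tau>
    using Rle[of \<tau>] v0 r that by (cases "\<tau> = r") (auto simp: R_def not_less[symmetric])
  show "\<exists>\<tau>\<in>{0..<r}. e < \<tau> \<and> v \<tau> < 0" if er: "e < r" for e
  proof -
    obtain \<tau> where \<tau>: "\<tau> \<in> R" "\<tau> > e"
      using less_cSupD[OF R(1), of e] er by (auto simp: r_def)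
    then have "\<tau> \<noteq> r" using v0 by (auto simp: R_def)
    then show ?thesis
      using \<tau> Rle[of \<tau>] by (intro bexI[of _ \<tau>]) (auto simp: R_def)
  qed
qed

lemma no_zero_pos:
  fixes v :: "real \<Rightarrow> real"
  assumes "continuous_on {a..b} v" "v a > 0" "\<And>\<tau>. \<tau> \<in> {a..b} \<Longrightarrow> v \<tau> \<noteq> 0" "a \<le> b"
  shows "v b > 0"
proof (rule ccontr)
  assume "\<not> v b > 0"
  then obtain \<tau> where "a \<le> \<tau>" "\<tau> \<le> b" "v \<tau> = 0"
    using IVT2'[of v b 0 a] assms by auto
  then show False using assms(3) by auto
qed

text \<open>Applied with \<open>u\<close> the signed horizontal distance of a path from a vertical line and \<open>M\<close> the
  number of turns it has made around a point beyond that line. Maximal excursions into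
  \<open>u \<ge> 0\<close> are pairwise separated, so each of them accounts for two zeros of its own, even if it
  touches the line in between.\<close>

lemma excursion_count:
  fixes u M :: "real \<Rightarrow> real"
  assumes cont: "continuous_on {0..1} u" and fin: "finite {\<tau>\<in>{0..1}. u \<tau> = 0}" and u0: "u 0 < 0"
    and neg: "\<And>s t. 0 \<le> s \<Longrightarrow> s \<le> t \<Longrightarrow> t \<le> 1 \<Longrightarrow> (\<And>\<tau>. \<tau> \<in> {s..t} \<Longrightarrow> u \<tau> \<le> 0) \<Longrightarrow> M t = M s"
    and pos: "\<And>s t. 0 \<le> s \<Longrightarrow> s < t \<Longrightarrow> t \<le> 1 \<Longrightarrow> (\<And>\<tau>. \<tau> \<in> {s..t} \<Longrightarrow> u \<tau> \<ge> 0) \<Longrightarrow>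
                u s = 0 \<Longrightarrow> u t = 0 \<Longrightarrow> M t \<le> M s + 1"
    and t: "t \<in> {0..1}" "u t < 0"
  shows "2 * (M t - M 0) \<le> card {\<tau>\<in>{0..t}. u \<tau> = 0}"
proof -
  define C where "C t = {\<tau>\<in>{0..t}. u \<tau> = 0}" for t
  have finC: "finite (C t)" if "t \<le> 1" for t
    using fin by (rule finite_subset[rotated]) (use that in \<open>auto simp: C_def\<close>)
  \<comment> \<open>Finiteness of the zero set is used here: to the left of every point there is a
    stretch without zeros.\<close>
  have gap: "\<exists>e<x. \<forall>\<tau>\<in>{0..1}. e < \<tau> \<and> \<tau> < x \<longrightarrow> u \<tau> \<noteq> 0" for x
  proof -
    define Z where "Z = insert (x - 1) {\<tau>\<in>{0..1}. u \<tau> = 0 \<and> \<tau> < x}"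
    have "finite Z" unfolding Z_def
      by (rule finite.insertI, rule finite_subset[OF _ fin]) auto
    moreover have "Z \<noteq> {}" "\<And>z. z \<in> Z \<Longrightarrow> z < x" by (auto simp: Z_def)
    ultimately have "Max Z < x" by simp
    moreover have "u \<tau> \<noteq> 0" if "\<tau> \<in> {0..1}" "Max Z < \<tau>" "\<tau> < x" for \<tau>
    proof
      assume "u \<tau> = 0"
      then have "\<tau> \<in> Z" using that by (auto simp: Z_def)
      then show False using Max_ge[OF \<open>finite Z\<close>] that by fastforce
    qed
    ultimately show ?thesis by blast
  qed
  have "2 * (M t - M 0) \<le> card (C t)"
    using t
  \<comment> \<open>Induction on the number of zeros up to \<open>t\<close>: the last excursion
    before \<open>t\<close> is cut off together with two zeros.\<close>
  proof (induction "card (C t)" arbitrary: t rule: less_induct)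
    case less
    show ?case
    proof (cases "\<exists>\<tau>\<in>{0..t}. u \<tau> > 0")
      case False
      then have "M t = M 0"
        using less.prems by (intro neg) (auto simp: not_less)
      then show ?thesis by simp
    next
      case True
      then obtain y where y: "y \<in> {0..t}" "u y > 0" by blast
      have "continuous_on {0..t} (\<lambda>\<tau>. - u \<tau>)"
        by (intro continuous_intros continuous_on_subset[OF cont]) (use less.prems in auto)
      \<comment> \<open>\<open>s\<close> is the end of the last excursion: \<open>u\<close> takes
        positive values arbitrarily shortly before \<open>s\<close> and none between
        \<open>s\<close> and \<open>t\<close>.\<close>
      from last_sign_change[OF this, of y] y less.prems
      obtain s where s: "y \<le> s" "s < t" "u s = 0" "\<And>\<tau>. \<tau> \<in> {s..t} \<Longrightarrow> u \<tau> \<le> 0"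
        and near_s: "\<And>e. e < s \<Longrightarrow> \<exists>\<tau>\<in>{0..<s}. e < \<tau> \<and> u \<tau> > 0"
        by auto
      have Mts: "M t = M s"
        using s y less.prems by (intro neg) auto
      obtain e where e: "e < s" "\<And>\<tau>. \<tau> \<in> {0..1} \<Longrightarrow> e < \<tau> \<Longrightarrow> \<tau> < s \<Longrightarrow> u \<tau> \<noteq> 0"
        using gap[of s] by blast
      obtain x where x: "x \<in> {0..<s}" "e < x" "u x > 0"
        using near_s[OF e(1)] by blast
      have "continuous_on {0..x} u"
        by (intro continuous_on_subset[OF cont]) (use x s less.prems in auto)
      \<comment> \<open>\<open>r\<close> is the beginning of the same excursion, found by going back
        from a time \<open>x\<close> just before \<open>s\<close>. Zeros strictly between
        \<open>r\<close> and \<open>s\<close> do no harm.\<close>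
      from last_sign_change[OF this, of 0] x u0
      obtain r where r: "0 \<le> r" "r < x" "u r = 0" "\<And>\<tau>. \<tau> \<in> {r..x} \<Longrightarrow> u \<tau> \<ge> 0"
        and near_r: "\<And>e. e < r \<Longrightarrow> \<exists>\<tau>\<in>{0..<r}. e < \<tau> \<and> u \<tau> < 0"
        by auto
      have "u \<tau> \<ge> 0" if \<tau>: "\<tau> \<in> {r..s}" for \<tau>
      proof -
        consider "\<tau> \<le> x" | "\<tau> = s" | "x < \<tau>" "\<tau> < s" using \<tau> by (cases "\<tau> \<le> x"; cases "\<tau> = s") auto
        then show ?thesis
        proof cases
          case 3
          then have "u \<tau> > 0"
            using x s less.prems e(2)
            by - (rule no_zero_pos[OF continuous_on_subset[OF cont]], auto)
          then show ?thesis by simp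
        qed (use r \<tau> s in auto)
      qed
      then have Mrs: "M s \<le> M r + 1"
        using r x s less.prems by (intro pos) auto
      obtain e' where e': "e' < r" "\<And>\<tau>. \<tau> \<in> {0..1} \<Longrightarrow> e' < \<tau> \<Longrightarrow> \<tau> < r \<Longrightarrow> u \<tau> \<noteq> 0"
        using gap[of r] by blast
      \<comment> \<open>\<open>t'\<close> precedes \<open>r\<close> with no zero in between, so
        \<open>M\<close> does not change from \<open>t'\<close> to \<open>r\<close>, and
        \<open>r\<close> and \<open>s\<close> are not among the zeros counted up to
        \<open>t'\<close>.\<close>
      obtain t' where t': "t' \<in> {0..<r}" "e' < t'" "u t' < 0"
        using near_r[OF e'(1)] by blast
      have "M r = M t'"
      proof (rule neg)
        fix \<tau> assume \<tau>: "\<tau> \<in> {t'..r}"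
        show "u \<tau> \<le> 0"
        proof (cases "\<tau> = r")
          case False
          have "- u \<tau> > 0"
            using \<tau> False t' r x s less.prems e'(2)
            by - (rule no_zero_pos[OF continuous_on_minus[OF continuous_on_subset[OF cont]]], auto)
          then show ?thesis by simp
        qed (use r in simp)
      qed (use t' r x s less.prems in auto)
      moreover have "C t' \<union> {r, s} \<subseteq> C t" "C t' \<inter> {r, s} = {}" "r \<noteq> s"
        using t' r x s by (auto simp: C_def)
      then have c: "card (C t') + 2 \<le> card (C t)"
        using card_mono[OF finC[of t], of "C t' \<union> {r, s}"] card_Un_disjoint[of "C t'" "{r,s}"]
          finC[of t'] t' r x s less.prems by auto
      moreover have "2 * (M t' - M 0) \<le> card (C t')"
        using c t' r x s less.prems by (intro less.hyps) auto
      ultimately show ?thesis using Mts Mrs by simp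
    qed
  qed
  then show ?thesis by (simp add: C_def)
qed

lemma Re_pos_not_nonpos_Reals: "Re z > 0 \<Longrightarrow> z \<notin> \<real>\<^sub>\<le>\<^sub>0"
  by (auto simp: complex_nonpos_Reals_iff)

section \<open>Turns of a simple arc about a point beyond a line\<close>

lemma arc_winding_crossings:
  assumes "arc g" and g0: "Re (g 0) < m" "Im (g 0) = Im q" and g1: "Re (g 1) < m" "Im (g 1) = Im q"
    and q: "m < Re q" "q \<notin> path_image g" and fin: "finite {t\<in>{0..1}. Re (g t) = m}"
  shows "2 * Re (winding_number g q) \<le> card {t\<in>{0..1}. Re (g t) = m}"
proof -
  \<comment> \<open>Left of the line, \<open>q - g t\<close> stays in the right half-plane, where
    the principal argument is continuous. Subtracting it makes \<open>M\<close> constant there. At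
    both ends of \<open>g\<close> the argument is 0, because they lie at the height of
    \<open>q\<close>; so the total change of \<open>M\<close> is the winding number itself.\<close>
  define M where "M t = Re (winding_number (subpath 0 t g) q) - Arg (q - g t) / (2 * pi)" for t
  have path: "path g" and inj: "inj_on g {0..1}" using \<open>arc g\<close> by (auto simp: arc_def)
  have slit: "Re (winding_number p q) = (Arg (q - p 1) - Arg (q - p 0)) / (2 * pi)"
    if "path p" "\<And>t. t \<in> {0..1} \<Longrightarrow> Re (p t) \<le> m" for p
  proof -
    have "Re ((p t - q) * -1) > 0" if "t \<in> {0..1}" for t
      using \<open>t \<in> {0..1} \<Longrightarrow> Re (p t) \<le> m\<close> that q by simp
    then show ?thesis
      using Re_winding_number_slit[OF \<open>path p\<close>, of "-1" q] Re_pos_not_nonpos_Reals by force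
  qed
  have diff: "M t - M s = Re (winding_number (subpath s t g) q) - (Arg (q - g t) - Arg (q - g s)) / (2 * pi)"
    if "s \<in> {0..1}" "t \<in> {0..1}" for s t
    using arg_cong[OF winding_number_subpath_combine[OF path q(2), of 0 s t], of Re] that
    by (simp add: M_def diff_divide_distrib)
  have Arg0: "Arg (q - z) = 0" if "Re z < m" "Im z = Im q" for z
    using that q by (subst Arg_eq_0) (auto simp: complex_is_Real_iff)
  have sub: "path (subpath s t g)" "q \<notin> path_image (subpath s t g)" if "s \<in> {0..1}" "t \<in> {0..1}" for s t
    using path q path_image_subpath_subset[of s t g] that by auto
  have "2 * (M 1 - M 0) \<le> card {t\<in>{0..1}. Re (g t) - m = 0}"
  proof (rule excursion_count)
    show "continuous_on {0..1} (\<lambda>t. Re (g t) - m)"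
      using path by (auto simp: path_def intro!: continuous_intros)
  next
    fix s t :: real
    assume st: "0 \<le> s" "s \<le> t" "t \<le> 1" and le: "\<And>\<tau>. \<tau> \<in> {s..t} \<Longrightarrow> Re (g \<tau>) - m \<le> 0"
    have "(t - s) * x + s \<in> {s..t}" if "x \<in> {0..1}" for x
      using that st mult_left_le[of x "t - s"] by auto
    then have "Re (subpath s t g x) \<le> m" if "x \<in> {0..1}" for x
      using le that by (force simp: subpath_def)
    from slit[OF _ this] sub[of s t] st
    show "M t = M s"
      using diff[of s t] by (simp add: subpath_def)
  next
    fix s t :: real
    assume st: "0 \<le> s" "s < t" "t \<le> 1" and ge: "\<And>\<tau>. \<tau> \<in> {s..t} \<Longrightarrow> Re (g \<tau>) - m \<ge> 0"
      and "Re (g s) - m = 0" "Re (g t) - m = 0"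
    then have Re: "Re (g s) = m" "Re (g t) = m" by auto
    have st01: "s \<in> {0..1}" "t \<in> {0..1}" using st by auto
    have "g s \<noteq> g t" using inj_onD[OF inj, of s t] st by auto
    with Re have Im: "Im (g s) \<noteq> Im (g t)" by (simp add: complex_eq_iff)
    txt \<open>An excursion to the right of the line, closed up by a hook on its left, is a Jordan curve.\<close>
    define c where "c = Complex (m - 1) 0"
    define d where "d = linepath (g t) c +++ linepath c (g s)"
    have L1: "z \<in> {g t} \<or> Re z < m" "Re z \<le> m" if "z \<in> closed_segment (g t) c" for z
    proof -
      obtain a where a: "0 \<le> a" "a \<le> 1" "z = (1 - a) *\<^sub>R g t + a *\<^sub>R c"
        using \<open>z \<in> closed_segment (g t) c\<close> by (auto simp: closed_segment_def)
      have "Re z = m - a" unfolding a(3) by (simp add: Re c_def algebra_simps)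
      with a show "z \<in> {g t} \<or> Re z < m" "Re z \<le> m" by (cases "a = 0"; simp)+
    qed
    have L2: "z \<in> {g s} \<or> Re z < m" "Re z \<le> m" if "z \<in> closed_segment c (g s)" for z
    proof -
      obtain a where a: "0 \<le> a" "a \<le> 1" "z = (1 - a) *\<^sub>R g s + a *\<^sub>R c"
        using \<open>z \<in> closed_segment c (g s)\<close> unfolding closed_segment_commute[of c]
        by (auto simp: closed_segment_def)
      have "Re z = m - a" unfolding a(3) by (simp add: Re c_def algebra_simps)
      with a show "z \<in> {g s} \<or> Re z < m" "Re z \<le> m" by (cases "a = 0"; simp)+
    qed
    have "arc d"
      unfolding d_def
    proof (rule arc_join)
      have "Re c \<noteq> m" by (simp add: c_def)
      then have "g t \<noteq> c" "c \<noteq> g s" using Re by auto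
      then show "arc (linepath (g t) c)" "arc (linepath c (g s))" by auto
      show "path_image (linepath (g t) c) \<inter> path_image (linepath c (g s)) \<subseteq> {pathstart (linepath c (g s))}"
      proof
        fix z assume "z \<in> path_image (linepath (g t) c) \<inter> path_image (linepath c (g s))"
        then have "z \<in> closed_segment (g t) c" "z \<in> closed_segment (g s) c"
          by (auto simp: closed_segment_commute)
        \<comment> \<open>Along either segment the real part falls from \<open>m\<close> at unit
          rate, so a common point has the same parameter on both. As the segments start at different
          heights, only the corner \<open>c\<close> remains.\<close>
        then obtain a b where a: "z = (1 - a) *\<^sub>R g t + a *\<^sub>R c" and b: "z = (1 - b) *\<^sub>R g s + b *\<^sub>R c"
          unfolding closed_segment_def by blast
        have "m - a = Re z" unfolding a by (simp add: Re c_def algebra_simps)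
        also have "\<dots> = m - b" unfolding b by (simp add: Re c_def algebra_simps)
        finally have "b = a" by simp
        then have "(1 - a) * (Im (g t) - Im (g s)) = 0"
          using arg_cong[OF trans[OF a[symmetric] b], of Im] by (simp add: c_def left_diff_distrib' right_diff_distrib')
        with Im have "a = 1" by auto
        with a show "z \<in> {pathstart (linepath c (g s))}" by simp
      qed
    qed auto
    have d_im: "z = g s \<or> z = g t \<or> Re z < m" "Re z \<le> m" if "z \<in> path_image d" for z
      using that L1 L2 by (auto simp: d_def path_image_join)
    have "simple_path (subpath s t g +++ d)"
    proof (rule simple_path_join_loop)
      show "arc (subpath s t g)" using st by (intro arc_subpath_arc \<open>arc g\<close>) auto
      show "path_image (subpath s t g) \<inter> path_image d \<subseteq> {pathstart (subpath s t g), pathstart d}"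
      proof
        fix z assume z: "z \<in> path_image (subpath s t g) \<inter> path_image d"
        then have "Re z \<ge> m" using ge st by (auto simp: path_image_subpath)
        then show "z \<in> {pathstart (subpath s t g), pathstart d}"
          using d_im[of z] z by (auto simp: d_def)
      qed
    qed (use \<open>arc d\<close> in \<open>auto simp: d_def\<close>)
    moreover have "q \<notin> path_image d" using d_im(2)[of q] q by auto
    ultimately have "winding_number (subpath s t g +++ d) q \<in> {-1, 0, 1}"
      using sub(2)[OF st01]
      by (intro simple_closed_path_winding_number_cases) (auto simp: d_def path_image_join)
    moreover have "winding_number (subpath s t g +++ d) q
        = winding_number (subpath s t g) q + winding_number d q"
      using sub[OF st01] \<open>q \<notin> path_image d\<close> \<open>arc d\<close>
      by (intro winding_number_join) (auto simp: d_def arc_imp_path)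
    ultimately have "Re (winding_number (subpath s t g) q) + Re (winding_number d q) \<le> 1"
      by (metis (no_types, lifting) insertE singletonD plus_complex.sel(1) one_complex.sel(1)
          uminus_complex.sel(1) zero_complex.sel(1) order_refl zero_le_one neg_le_0_iff_le order_trans)
    moreover have "Re (winding_number d q) = (Arg (q - g s) - Arg (q - g t)) / (2 * pi)"
      using slit[of d] \<open>arc d\<close> d_im(2)
      by (auto simp: arc_imp_path d_def path_image_def joinpaths_def linepath_def)
    ultimately show "M t \<le> M s + 1"
      using diff[OF st01] by (simp add: diff_divide_distrib)
  qed (use fin g0 g1 in auto)
  moreover have "M 1 - M 0 = Re (winding_number g q)"
    using diff[of 0 1] Arg0 g0 g1 by simp
  ultimately show ?thesis by simp
qed

section \<open>Images of segments, point reflections and half turns\<close>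

text \<open>A segment is simply connected, so \<open>g\<close> is homotopic in it to the straight
  path, and \<open>f\<close> carries the homotopy into the complement of \<open>w\<close>. This
  permits cutting and reparametrizing the arcs of a diagram.\<close>

lemma winding_compose_path_in_segment:
  assumes "path g" "path_image g \<subseteq> closed_segment a b" "g 0 = a" "g 1 = b"
    and "continuous_on (closed_segment a b) f" "w \<notin> f ` closed_segment a b"
  shows "winding_number (f \<circ> g) w = winding_number (f \<circ> linepath a b) w"
proof (rule winding_number_homotopic_paths, rule homotopic_paths_continuous_image)
  have "pathstart g = a" "pathfinish g = b"
    using assms by (simp_all add: pathstart_def pathfinish_def)
  then show "homotopic_paths (closed_segment a b) g (linepath a b)"
    using assms(1,2)
    by - (rule simply_connected_eq_homotopic_paths[THEN iffD1, THEN conjunct2, rule_format],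
      auto simp: convex_imp_simply_connected)
qed (use assms in auto)

lemma winding_compose_linepath_split:
  assumes "c \<in> closed_segment a b" "continuous_on (closed_segment a b) f" "w \<notin> f ` closed_segment a b"
  shows "winding_number (f \<circ> linepath a b) w =
    winding_number (f \<circ> linepath a c) w + winding_number (f \<circ> linepath c b) w"
proof -
  have sub: "closed_segment a c \<subseteq> closed_segment a b" "closed_segment c b \<subseteq> closed_segment a b"
    using assms(1) by (auto simp: subset_closed_segment)
  have "winding_number (f \<circ> linepath a b) w = winding_number (f \<circ> (linepath a c +++ linepath c b)) w"
    using sub assms
    by (intro winding_compose_path_in_segment[symmetric] path_join_imp)
      (auto simp: path_image_join, auto simp: joinpaths_def linepath_def)
  also have "\<dots> = winding_number ((f \<circ> linepath a c) +++ (f \<circ> linepath c b)) w"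
    by (simp add: path_compose_join)
  also have "\<dots> = winding_number (f \<circ> linepath a c) w + winding_number (f \<circ> linepath c b) w"
    using sub assms
    by (intro winding_number_join path_continuous_image)
      (auto simp: path_image_compose pathfinish_compose pathstart_compose intro: continuous_on_subset)
  finally show ?thesis .
qed

text \<open>A point reflection is a rotation by pi: it adds a constant to a continuous logarithm and
  leaves the increment unchanged.\<close>

lemma winding_number_reflect:
  assumes "path g" "w \<notin> path_image g"
  shows "winding_number (\<lambda>t. c - g t) (c - w) = winding_number g w"
proof -
  obtain l where l: "path l" "pathfinish l - pathstart l = 2 * of_real pi * \<i> * winding_number g w"
    "\<And>t. t \<in> {0..1} \<Longrightarrow> g t = w + exp (l t)"
    using winding_number_as_continuous_log[OF assms] by blast
  have "path (\<lambda>t. l t + \<i> * of_real pi)"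
    using l(1) unfolding path_def by (intro continuous_intros)
  have "winding_number (\<lambda>t. c - g t) (c - w) = winding_number (\<lambda>t. c - g t - (c - w)) 0"
    by (rule winding_number_offset)
  also have "\<dots> = winding_number (exp \<circ> (\<lambda>t. l t + \<i> * of_real pi)) 0"
    by (rule winding_number_cong) (simp add: l(3) exp_add)
  also have "\<dots> = winding_number g w"
    using winding_number_compose_exp[OF \<open>path (\<lambda>t. l t + \<i> * of_real pi)\<close>] l(2)
    by (simp add: pathstart_def pathfinish_def)
  finally show ?thesis .
qed

text \<open>The slit points straight down from \<open>w\<close>; measured from it, the argument
  grows from -pi/2 to pi/2. The path may run along the real axis as long as it misses
  \<open>w\<close>.\<close>

lemma Re_winding_upper_half:
  assumes "path g" and up: "\<And>t. t \<in> {0..1} \<Longrightarrow> Im (g t) \<ge> 0 \<and> g t \<noteq> of_real w"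
    and "g 0 = of_real x" "w < x" "g 1 = of_real y" "y < w"
  shows "Re (winding_number g (of_real w)) = 1 / 2"
proof -
  have "(g t - of_real w) * (- \<i>) \<notin> \<real>\<^sub>\<le>\<^sub>0" if "t \<in> {0..1}" for t
    using up[OF that] by (auto simp: complex_nonpos_Reals_iff complex_eq_iff)
  note * = Re_winding_number_slit[OF \<open>path g\<close> _ this]
  have "Arg \<i> = pi / 2" "Arg (- \<i>) = - pi / 2"
    by (simp_all add: Arg_eq_Im_Ln)
  moreover have "(g 1 - of_real w) * (- \<i>) = of_real (w - y) * \<i>"
    "(g 0 - of_real w) * (- \<i>) = of_real (x - w) * (- \<i>)"
    using assms by (simp_all add: algebra_simps)
  ultimately have Arg: "Arg ((g 1 - of_real w) * (- \<i>)) = pi / 2"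
    "Arg ((g 0 - of_real w) * (- \<i>)) = - pi / 2"
    using assms by (simp_all only: Arg_times_of_real diff_gt_0_iff_gt)
  have "Re (winding_number g (of_real w))
      = (Arg ((g 1 - of_real w) * (- \<i>)) - Arg ((g 0 - of_real w) * (- \<i>))) / (2 * pi)"
    by (rule *) simp
  also have "\<dots> = 1 / 2"
    by (simp only: Arg) simp
  finally show ?thesis .
qed

text \<open>Among the strands of \<open>h\<close> only those ending at \<open>u\<close> and \<open>v\<close> are considered, and \<open>k\<close> is the
  number of half twists that they make about each other. Real parts are taken because the winding
  number of an open path has the logarithm of a ratio of distances as its imaginary part.\<close>

definition pair_twist :: "(complex \<Rightarrow> complex) \<Rightarrow> real \<Rightarrow> real \<Rightarrow> real \<Rightarrow> real \<Rightarrow> nat \<Rightarrow> bool" where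
  "pair_twist h a b u v k \<longleftrightarrow> (\<exists>s t. a < s \<and> s < t \<and> t < b \<and>
     {h (of_real s), h (of_real t)} = {of_real u, of_real v} \<and>
     2 * Re (winding_number (h \<circ> linepath (of_real a) (of_real s)) (h (of_real t))) = k \<and>
     2 * Re (winding_number (h \<circ> linepath (of_real b) (of_real t)) (h (of_real s))) = k)"

section \<open>Crossings forced on a curve diagram\<close>

text \<open>The points -1, \<open>x\<close> and \<open>y\<close> are real, hence at equal height. If
  \<open>x < m\<close>, the arc starts and ends on the side opposite to \<open>y\<close>, and
  \<open>arc_winding_crossings\<close> applies directly; the other case needs a longer arc.\<close>

lemma end_arc_crossings:
  fixes s t x y m :: real
  assumes cont: "continuous_on UNIV h" and inj: "inj h" and ball: "\<And>z. cmod z < 1 \<Longrightarrow> cmod (h z) < 1"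
    and hm1: "h (-1) = -1" and st: "-1 < s" "s < 1" "t < 1" "s < t"
    and hs: "h (of_real s) = of_real x" and ht: "h (of_real t) = of_real y"
    and m: "x < m \<and> m < y \<or> y < m \<and> m < x"
    and fin: "finite {r\<in>{-1..s}. Re (h (of_real r)) = m}"
  shows "2 * Re (winding_number (h \<circ> linepath (-1) (of_real s)) (h (of_real t)))
           \<le> card {r\<in>{-1..s}. Re (h (of_real r)) = m}"
proof -
  define g where "g = h \<circ> linepath (-1) (of_real s)"
  define R where "R = {r\<in>{-1..s}. Re (h (of_real r)) = m}"
  have g_eq: "g \<tau> = h (of_real (\<tau> * (s + 1) - 1))" for \<tau>
    by (simp add: g_def linepath_def scaleR_conv_of_real algebra_simps)
  have range: "\<tau> * (s + 1) - 1 \<in> {-1..s}" if "\<tau> \<in> {0..1}" for \<tau>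
  proof -
    have "0 \<le> \<tau> * (s + 1)" "\<tau> * (s + 1) \<le> s + 1"
      using that st by (auto intro: mult_left_le_one_le)
    then show ?thesis unfolding atLeastAtMost_iff by linarith
  qed
  have g01: "g 0 = -1" "g 1 = of_real x"
    using hm1 hs by (simp_all add: g_def linepath_def)
  have "arc g"
    unfolding arc_def
  proof
    show "path g" unfolding g_def
      by (intro path_continuous_image continuous_on_subset[OF cont]) auto
    show "inj_on g {0..1}"
    proof (rule inj_onI)
      fix \<tau> \<tau>' assume "g \<tau> = g \<tau>'"
      then have "complex_of_real (\<tau> * (s + 1) - 1) = of_real (\<tau>' * (s + 1) - 1)"
        unfolding g_eq by (rule injD[OF inj])
      then show "\<tau> = \<tau>'" using st by (simp only: of_real_eq_iff) simp
    qed
  qed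
  have xy: "\<bar>x\<bar> < 1" "\<bar>y\<bar> < 1"
    using ball[of "of_real s"] ball[of "of_real t"] st hs ht by auto
  have q: "h (of_real t) \<notin> path_image g"
  proof
    assume "h (of_real t) \<in> path_image g"
    then obtain \<tau> where "\<tau> \<in> {0..1}" "h (of_real t) = h (of_real (\<tau> * (s + 1) - 1))"
      unfolding path_image_def g_eq by blast
    moreover from this(2) have "t = \<tau> * (s + 1) - 1"
      by (simp only: inj_eq[OF inj] of_real_eq_iff)
    ultimately have "\<tau> \<in> {0..1}" "t = \<tau> * (s + 1) - 1" by auto
    then show False
      using st range[of \<tau>] by auto
  qed
  have cross: "{\<tau>\<in>{0..1}. Re (g \<tau>) = m} \<subseteq> (\<lambda>r. (r + 1) / (s + 1)) ` R"
  proof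
    fix \<tau> assume "\<tau> \<in> {\<tau>\<in>{0..1}. Re (g \<tau>) = m}"
    then have "\<tau> * (s + 1) - 1 \<in> R"
      using range[of \<tau>] by (simp add: R_def g_eq)
    then show "\<tau> \<in> (\<lambda>r. (r + 1) / (s + 1)) ` R"
      using st by (intro image_eqI[of _ _ "\<tau> * (s + 1) - 1"]) auto
  qed
  have "finite R" using fin by (simp add: R_def)
  have "2 * Re (winding_number g (h (of_real t))) \<le> card R"
  proof (cases "x < m")
    case True
    have "2 * Re (winding_number g (h (of_real t))) \<le> card {\<tau>\<in>{0..1}. Re (g \<tau>) = m}"
      using \<open>arc g\<close> True m xy g01 q ht finite_surj[OF \<open>finite R\<close> cross]
      by (intro arc_winding_crossings) auto
    also have "\<dots> \<le> card R"
      using surj_card_le[OF \<open>finite R\<close> cross] by simp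
    finally show ?thesis .
  next
    case False
    with m have m: "y < m" "m < x" by auto
    txt \<open>Here the arc starts on the side of the point it winds around. Prepending a semicircle
      outside the disk moves the start to the other side; it adds one crossing and half a turn.\<close>
    define c where "c = part_circlepath 1 2 0 pi"
    have c_eq: "c \<tau> = 1 + 2 * cis (pi * \<tau>)" for \<tau>
      by (simp add: c_def part_circlepath_def linepath_def cis_conv_exp algebra_simps)
    have c01: "c 0 = 3" "c 1 = -1" by (simp_all add: c_eq)
    have "arc c" unfolding c_def by (intro arc_part_circlepath) auto
    have c_im: "Im (c \<tau>) \<ge> 0" if "\<tau> \<in> {0..1}" for \<tau>
      using that by (auto simp: c_eq intro!: sin_ge_zero)
    \<comment> \<open>The circle of radius 2 about 1 meets the closed unit disk only at -1, and
      \<open>g\<close> stays in the open disk after time 0. Hence the concatenation is still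
      injective.\<close>
    have c_norm: "cmod z \<ge> 1" if "z \<in> path_image c" for z
    proof -
      have "cmod (z - 1) = 2" using that by (auto simp: path_image_def c_eq norm_mult)
      then show ?thesis using norm_triangle_ineq4[of z 1] by simp
    qed
    have qc: "h (of_real t) \<notin> path_image c"
      using c_norm[of "h (of_real t)"] ht xy by auto
    have "arc (c +++ g)"
    proof (rule arc_join)
      show "path_image c \<inter> path_image g \<subseteq> {pathstart g}"
      proof
        fix z assume z: "z \<in> path_image c \<inter> path_image g"
        then obtain \<tau> where \<tau>: "\<tau> \<in> {0..1}" "z = g \<tau>" by (auto simp: path_image_def)
        have "\<tau> = 0"
        proof (rule ccontr)
          assume "\<tau> \<noteq> 0"
          then have "\<bar>\<tau> * (s + 1) - 1\<bar> < 1"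
            using \<tau> st range[of \<tau>] by (auto simp: abs_less_iff)
          then have "cmod z < 1" unfolding \<tau> g_eq by (intro ball) (simp del: of_real_diff of_real_mult)
          then show False using c_norm z by fastforce
        qed
        then show "z \<in> {pathstart g}" using \<tau> by (simp add: pathstart_def)
      qed
    qed (use \<open>arc c\<close> \<open>arc g\<close> c01 g01 in \<open>auto simp: pathstart_def pathfinish_def\<close>)
    have "c \<tau> \<noteq> of_real y" if "\<tau> \<in> {0..1}" for \<tau>
      using qc that unfolding ht path_image_def by force
    then have wc: "Re (winding_number c (h (of_real t))) = 1 / 2"
      unfolding ht using \<open>arc c\<close> c_im c01 xy
      by (intro Re_winding_upper_half[of c y 3 "-1"]) (auto simp: arc_imp_path)
    \<comment> \<open>The negation turns the picture around, so that both ends lie to the left of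
      the line and the center to its right, as \<open>arc_winding_crossings\<close> expects.\<close>
    define j where "j = (\<lambda>\<tau>. - (c +++ g) \<tau>)"
    have path_j: "path (c +++ g)" using \<open>arc (c +++ g)\<close> by (rule arc_imp_path)
    have q': "h (of_real t) \<notin> path_image (c +++ g)"
      using q qc c01 g01 by (subst path_image_join) (auto simp: pathstart_def pathfinish_def)
    have "winding_number j (- h (of_real t)) = winding_number (c +++ g) (h (of_real t))"
      unfolding j_def using winding_number_reflect[OF path_j q', of 0] by simp
    also have "\<dots> = winding_number c (h (of_real t)) + winding_number g (h (of_real t))"
      using \<open>arc c\<close> \<open>arc g\<close> q qc c01 g01
      by (intro winding_number_join) (auto simp: pathstart_def pathfinish_def arc_imp_path)
    also have "Re \<dots> = 1 / 2 + Re (winding_number g (h (of_real t)))"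
      using wc by simp
    finally have wj: "Re (winding_number j (- h (of_real t))) = 1 / 2 + Re (winding_number g (h (of_real t)))" .
    \<comment> \<open>The only time at which the semicircle meets the line: it solves
      \<open>1 + 2 * cos (pi * (2 * \<tau>)) = m\<close>, the factor 2 inside the cosine coming from
      the concatenation.\<close>
    define \<tau>0 where "\<tau>0 = arccos ((m - 1) / 2) / (2 * pi)"
    have cross_j: "{\<tau>\<in>{0..1}. Re (j \<tau>) = - m} \<subseteq> insert \<tau>0 ((\<lambda>r. ((r + 1) / (s + 1) + 1) / 2) ` R)"
    proof
      fix \<tau> assume \<tau>: "\<tau> \<in> {\<tau>\<in>{0..1}. Re (j \<tau>) = - m}"
      show "\<tau> \<in> insert \<tau>0 ((\<lambda>r. ((r + 1) / (s + 1) + 1) / 2) ` R)"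
      proof (cases "\<tau> \<le> 1 / 2")
        case True
        then have c: "(m - 1) / 2 = cos (pi * (2 * \<tau>))"
          using \<tau> by (auto simp: j_def joinpaths_def c_eq)
        then have "pi * (2 * \<tau>) = arccos ((m - 1) / 2)"
          using True \<tau> unfolding c by (subst arccos_cos) auto
        then show ?thesis by (simp add: \<tau>0_def field_simps)
      next
        case False
        then have "2 * \<tau> - 1 \<in> {\<tau>\<in>{0..1}. Re (g \<tau>) = m}"
          using \<tau> by (auto simp: j_def joinpaths_def)
        then obtain r where "r \<in> R" "2 * \<tau> - 1 = (r + 1) / (s + 1)"
          using cross by blast
        then show ?thesis by (intro insertI2 image_eqI[of _ _ r]) auto
      qed
    qed
    have finR: "finite (insert \<tau>0 ((\<lambda>r. ((r + 1) / (s + 1) + 1) / 2) ` R))"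
      using \<open>finite R\<close> by simp
    have "arc j"
      using \<open>arc (c +++ g)\<close> unfolding arc_def j_def path_def inj_on_def
      by (auto intro!: continuous_intros)
    have "2 * Re (winding_number j (- h (of_real t))) \<le> card {\<tau>\<in>{0..1}. Re (j \<tau>) = - m}"
    proof (rule arc_winding_crossings[OF \<open>arc j\<close>])
      show "- h (of_real t) \<notin> path_image j"
        using q' by (auto simp: path_image_def j_def)
      show "finite {\<tau>\<in>{0..1}. Re (j \<tau>) = - m}"
        using finR cross_j by (rule finite_subset[rotated])
    qed (use m xy c01 g01 ht in \<open>auto simp: j_def joinpaths_def\<close>)
    also have "card {\<tau>\<in>{0..1}. Re (j \<tau>) = - m} \<le> Suc (card ((\<lambda>r. ((r + 1) / (s + 1) + 1) / 2) ` R))"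
      using card_mono[OF finR cross_j] \<open>finite R\<close> by (simp add: card_insert_if split: if_splits)
    also have "\<dots> \<le> Suc (card R)"
      using card_image_le[OF \<open>finite R\<close>] by simp
    finally show ?thesis using wj by simp
  qed
  then show ?thesis unfolding g_def R_def .
qed

text \<open>Each of the two end arcs contributes \<open>k\<close> crossings, and the arc between
  \<open>s\<close> and \<open>t\<close> one more, because its ends lie on different sides of the
  line. The three parameter ranges share only \<open>s\<close> and \<open>t\<close>, where no
  crossing occurs.\<close>

lemma pair_twist_crossings:
  assumes cont: "continuous_on UNIV h" and inj: "inj h" and ball: "\<And>z. cmod z < 1 \<Longrightarrow> cmod (h z) < 1"
    and h1: "h 1 = 1" "h (-1) = -1" and tw: "pair_twist h (-1) 1 u v k" and m: "u < m" "m < v"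
    and fin: "finite {r\<in>{-1..1}. Re (h (of_real r)) = m}"
  shows "2 * k + 1 \<le> card {r\<in>{-1..1}. Re (h (of_real r)) = m}"
proof -
  obtain s t where st: "-1 < s" "s < t" "t < 1" and im: "{h (of_real s), h (of_real t)} = {of_real u, of_real v}"
    and w1: "2 * Re (winding_number (h \<circ> linepath (-1) (of_real s)) (h (of_real t))) = k"
    and w2: "2 * Re (winding_number (h \<circ> linepath 1 (of_real t)) (h (of_real s))) = k"
    using tw by (auto simp: pair_twist_def)
  obtain x y where xy: "h (of_real s) = of_real x" "h (of_real t) = of_real y"
      "x < m \<and> m < y \<or> y < m \<and> m < x"
    using im m by (auto simp: doubleton_eq_iff)
  define X where "X = {r\<in>{-1..1}. Re (h (of_real r)) = m}"
  define A where "A = {r\<in>{-1..s}. Re (h (of_real r)) = m}"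
  define B where "B = {r\<in>{t..1}. Re (h (of_real r)) = m}"
  have sub: "A \<subseteq> X" "B \<subseteq> X" using st by (auto simp: X_def A_def B_def)
  have "finite X" using fin by (simp add: X_def)
  then have fAB: "finite A" "finite B" using sub by (auto intro: finite_subset)
  have kA: "k \<le> card A"
    using end_arc_crossings[OF cont inj ball h1(2), of s t x y m] st xy fAB w1
    by (simp add: A_def)
  \<comment> \<open>Conjugation by the point reflection exchanges the two ends of the diameter and
    preserves winding numbers, so the bound for the left end arc also covers the right one.\<close>
  define h' where "h' z = - h (- z)" for z
  define B' where "B' = {r\<in>{-1..-t}. Re (h' (of_real r)) = - m}"
  have "r \<in> B' \<longleftrightarrow> - r \<in> B" for r
    by (auto simp: B'_def B_def h'_def)
  then have B': "B' = uminus ` B"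
    by (intro set_eqI) (metis image_iff minus_minus)
  have path2: "path (h \<circ> linepath 1 (of_real t))"
    by (intro path_continuous_image continuous_on_subset[OF cont]) auto
  have s2: "h (of_real s) \<notin> path_image (h \<circ> linepath 1 (of_real t))"
  proof
    assume "h (of_real s) \<in> path_image (h \<circ> linepath 1 (of_real t))"
    then have "complex_of_real s \<in> closed_segment (of_real 1) (of_real t)"
      by (simp add: path_image_compose inj_image_mem_iff[OF inj])
    then have "s \<in> closed_segment 1 t"
      unfolding closed_segment_of_real by (simp add: image_iff)
    then show False
      using st by (simp add: closed_segment_eq_real_ivl)
  qed
  have "2 * Re (winding_number (h' \<circ> linepath (-1) (of_real (- t))) (h' (of_real (- s)))) \<le> card B'"
    unfolding B'_def
  proof (rule end_arc_crossings)
    show "continuous_on UNIV h'"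
      unfolding h'_def by (intro continuous_intros continuous_on_compose2[OF cont]) auto
    show "inj h'" by (auto simp: inj_on_def h'_def dest!: injD[OF inj])
    show "cmod (h' z) < 1" if "cmod z < 1" for z
      using ball[of "- z"] that by (simp add: h'_def)
    show "h' (of_real (- t)) = of_real (- y)" "h' (of_real (- s)) = of_real (- x)" "h' (-1) = -1"
      using xy h1 by (simp_all add: h'_def)
    show "finite {r\<in>{-1..-t}. Re (h' (of_real r)) = - m}"
      unfolding B'_def[symmetric] B' using fAB by simp
  qed (use st xy in auto)
  moreover have "h' \<circ> linepath (-1) (of_real (- t)) = (\<lambda>\<tau>. - (h \<circ> linepath 1 (of_real t)) \<tau>)"
    by (auto simp: fun_eq_iff h'_def linepath_def add.commute)
  ultimately have kB: "k \<le> card B"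
    using w2 winding_number_reflect[OF path2 s2, of 0] by (simp add: h'_def B' card_image)
  have "continuous_on {s..t} (\<lambda>r. Re (h (of_real r)))"
    by (intro continuous_intros continuous_on_compose2[OF cont]) auto
  then obtain r where r: "s \<le> r" "r \<le> t" "Re (h (of_real r)) = m"
    using IVT'[of "\<lambda>r. Re (h (of_real r))" s m t] IVT2'[of "\<lambda>r. Re (h (of_real r))" t m s] xy st by force
  then have rst: "s < r" "r < t" using xy by (auto simp: less_le)
  have eq: "card (insert r (A \<union> B)) = Suc (card A + card B)"
    using rst st fAB by (subst card_insert_disjoint; (subst card_Un_disjoint)?) (auto simp: A_def B_def)
  have "insert r (A \<union> B) \<subseteq> X" using sub r rst st by (auto simp: X_def)
  then have "card (insert r (A \<union> B)) \<le> card X" by (intro card_mono \<open>finite X\<close>)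
  then show ?thesis unfolding eq X_def[symmetric] using kA kB by simp
qed

lemma Re_winding_lower_half:
  assumes "path g" and low: "\<And>t. t \<in> {0..1} \<Longrightarrow> Im (g t) \<le> 0 \<and> g t \<noteq> of_real w"
    and "g 0 = of_real x" "x < w" "g 1 = of_real y" "w < y"
  shows "Re (winding_number g (of_real w)) = 1 / 2"
proof -
  have "of_real w \<notin> path_image g" using low by (force simp: path_image_def)
  then have "winding_number g (of_real w) = winding_number (\<lambda>t. - g t) (of_real (- w))"
    using winding_number_reflect[of g "of_real w" 0] assms(1) by simp
  moreover have "Re (winding_number (\<lambda>t. - g t) (of_real (- w))) = 1 / 2"
  proof (rule Re_winding_upper_half)
    show "path (\<lambda>t. - g t)"
      using assms(1) unfolding path_def by (intro continuous_intros)
    show "0 \<le> Im (- g t) \<and> - g t \<noteq> of_real (- w)" if "t \<in> {0..1}" for t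
      using low[OF that] by simp
  qed (use assms in auto)
  ultimately show ?thesis by simp
qed

text \<open>The slit is the horizontal ray from \<open>w\<close> away from the path, and both ends
  have argument 0. The sign \<open>e\<close> tells on which side of \<open>w\<close> the path stays:
  1 for right, -1 for left.\<close>

lemma Re_winding_half_plane:
  assumes "path g" "e \<in> {-1, 1}" "\<And>t. t \<in> {0..1} \<Longrightarrow> e * Re (g t) > e * w"
    and "g 0 = of_real x" "g 1 = of_real y"
  shows "Re (winding_number g (of_real w)) = 0"
proof -
  have "(g t - of_real w) * of_real e \<notin> \<real>\<^sub>\<le>\<^sub>0" if "t \<in> {0..1}" for t
    using assms(2) assms(3)[OF that] by (intro Re_pos_not_nonpos_Reals) (auto simp: algebra_simps)
  then have "Re (winding_number g (of_real w))
      = (Arg ((g 1 - of_real w) * of_real e) - Arg ((g 0 - of_real w) * of_real e)) / (2 * pi)"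
    using assms by (intro Re_winding_number_slit) auto
  moreover have "(g 1 - of_real w) * of_real e = of_real (e * y - e * w)"
      "(g 0 - of_real w) * of_real e = of_real (e * x - e * w)"
    by (simp_all add: assms(4,5) algebra_simps)
  moreover have "e * y - e * w > 0" "e * x - e * w > 0"
    using assms(3)[of 0] assms(3)[of 1] assms(4,5) by auto
  ultimately show ?thesis by (simp only: Arg_of_real) simp
qed

section \<open>Homeomorphisms with prescribed twisting\<close>

definition diam_ball :: "real \<Rightarrow> real \<Rightarrow> complex set" where
  "diam_ball a b = ball (of_real ((a + b) / 2)) ((b - a) / 2)"

lemma diam_ball_of_real [simp]: "complex_of_real x \<in> diam_ball a b \<longleftrightarrow> a < x \<and> x < b"
proof -
  have "dist (complex_of_real ((a + b) / 2)) (of_real x) = \<bar>(a + b) / 2 - x\<bar>"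
    unfolding dist_of_real dist_real_def ..
  then show ?thesis
    unfolding diam_ball_def mem_ball by (simp only:) (auto simp: abs_less_iff field_simps)
qed

lemma diam_ball_Re: "z \<in> diam_ball a b \<Longrightarrow> a < Re z \<and> Re z < b"
proof -
  assume "z \<in> diam_ball a b"
  moreover have "\<bar>(a + b) / 2 - Re z\<bar> \<le> dist (complex_of_real ((a + b) / 2)) z"
    using abs_Re_le_cmod[of "of_real ((a + b) / 2) - z"] by (simp add: dist_norm)
  ultimately have "\<bar>(a + b) / 2 - Re z\<bar> < (b - a) / 2"
    by (simp add: diam_ball_def)
  then show ?thesis unfolding abs_less_iff by (auto simp: field_simps)
qed

lemma diam_ball_mono: "a \<le> a' \<Longrightarrow> b' \<le> b \<Longrightarrow> diam_ball a' b' \<subseteq> diam_ball a b"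
proof -
  assume "a \<le> a'" "b' \<le> b"
  then have "dist ((a' + b') / 2) ((a + b) / 2) + (b' - a') / 2 \<le> (b - a) / 2"
    by (auto simp: dist_real_def abs_if field_simps)
  then have "dist (complex_of_real ((a' + b') / 2)) (of_real ((a + b) / 2)) + (b' - a') / 2 \<le> (b - a) / 2"
    by (simp only: dist_of_real)
  then show ?thesis
    unfolding diam_ball_def ball_subset_ball_iff by blast
qed

text \<open>Surjectivity is a consequence, by invariance of domain; it is derived for the unit disk
  in \<open>disc_homeo_orientation_preserving\<close>.\<close>

definition disc_homeo :: "real \<Rightarrow> real \<Rightarrow> (complex \<Rightarrow> complex) \<Rightarrow> bool" where
  "disc_homeo a b h \<longleftrightarrow> continuous_on UNIV h \<and> inj h \<and> (\<forall>z. z \<notin> diam_ball a b \<longrightarrow> h z = z)"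

lemma disc_homeo_fix: "disc_homeo a b h \<Longrightarrow> z \<notin> diam_ball a b \<Longrightarrow> h z = z"
  by (simp add: disc_homeo_def)

lemma disc_homeo_mono: "disc_homeo a' b' h \<Longrightarrow> a \<le> a' \<Longrightarrow> b' \<le> b \<Longrightarrow> disc_homeo a b h"
  unfolding disc_homeo_def using diam_ball_mono by blast

text \<open>If \<open>h z\<close> were outside the disk, it would be fixed, and
  \<open>h (h z) = h z\<close> would give \<open>h z = z\<close> by injectivity.\<close>

lemma disc_homeo_maps: "disc_homeo a b h \<Longrightarrow> h z \<in> diam_ball a b \<longleftrightarrow> z \<in> diam_ball a b"
  unfolding disc_homeo_def by (metis injD)

lemma disc_homeo_compose: "disc_homeo a b f \<Longrightarrow> disc_homeo a b g \<Longrightarrow> disc_homeo a b (f \<circ> g)"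
  unfolding disc_homeo_def
  by (auto intro: continuous_on_compose2[where t = UNIV] inj_compose[unfolded o_def] simp: o_def)

lemma disc_homeo_id: "disc_homeo a b id"
  by (simp add: disc_homeo_def)

text \<open>The two outer pieces of the diameter become spirals: the left one runs from
  \<open>a\<close> below the axis to \<open>b'\<close>, the right one from \<open>b\<close> above
  the axis to \<open>a'\<close>. So each makes a positive half turn about every real point between
  \<open>a'\<close> and \<open>b'\<close>. Injectivity of the real part allows each spiral one
  crossing with a given line; these are the two crossings that a half twist may add.\<close>

lemma half_twist:
  assumes "a < a'" "a' < b'" "a' + b' = a + b"
  obtains T where "disc_homeo a b T"
    "\<And>z. z \<in> diam_ball a' b' \<Longrightarrow> T z = of_real (a + b) - z"
    "T (of_real a') = of_real b'" "T (of_real b') = of_real a'"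
    "\<And>x. x \<in> {a..a'} \<Longrightarrow> Im (T (of_real x)) \<le> 0"
    "\<And>x. x \<in> {b'..b} \<Longrightarrow> Im (T (of_real x)) \<ge> 0"
    "inj_on (\<lambda>x. Re (T (of_real x))) {a..a'}"
    "inj_on (\<lambda>x. Re (T (of_real x))) {b'..b}"
proof
  define c where "c = (a + b) / 2"
  define r where "r = (b' - a') / 2"
  define R where "R = (b - a) / 2"
  have rR: "0 < r" "r < R" using assms by (auto simp: r_def R_def)
  have ab: "a = c - R" "b = c + R" "a' = c - r" "b' = c + r"
    using assms by (auto simp: c_def r_def R_def field_simps)
  txt \<open>The circle of radius \<open>s\<close> is rotated by the angle \<open>\<theta> s\<close>, which is chosen such that
    \<open>s * cos (\<theta> s)\<close> is affine in \<open>s\<close>: then each of the two spirals into which the twist turns the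
    outer parts of the diameter meets a vertical line at most once.\<close>
  define l where "l s = - r + (s - r) * (R + r) / (R - r)" for s
  \<comment> \<open>The affine function \<open>l\<close> is determined by \<open>l r = - r\<close>
    and \<open>l R = R\<close>, the values for the angles pi and 0. Clamping the quotient continues
    the angle as the constant pi inside and 0 outside the annulus; \<open>max s r\<close> keeps the
    denominator away from 0 at the center.\<close>
  define \<theta> where "\<theta> s = arccos (max (- 1) (min 1 (l s / max s r)))" for s
  define T where "T z = of_real c + (z - of_real c) * cis (\<theta> (cmod (z - of_real c)))" for z
  have \<theta>_range: "0 \<le> \<theta> s" "\<theta> s \<le> pi" for s
    by (auto simp: \<theta>_def intro!: arccos_lbound arccos_ubound)
  have \<theta>_small: "\<theta> s = pi" if "s \<le> r" for s
  proof -
    have "l s \<le> - r" using that rR by (auto simp: l_def intro!: divide_nonpos_pos mult_nonpos_nonneg)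
    then have "l s / r \<le> -1" using rR by (simp add: field_simps)
    then show ?thesis using that by (simp add: \<theta>_def max_def)
  qed
  have l_ge: "l s \<ge> s" if "s \<ge> R" for s
  proof -
    have "(s - R) * (2 * r) \<ge> 0" using that rR by simp
    then show ?thesis using rR by (simp add: l_def field_simps)
  qed
  have \<theta>_large: "\<theta> s = 0" if "s \<ge> R" for s
  proof -
    have "l s / s \<ge> 1" using l_ge[OF that] that rR by (simp add: field_simps)
    then show ?thesis using that rR by (simp add: \<theta>_def max_def)
  qed
  have s_cos: "s * cos (\<theta> s) = l s" if "r \<le> s" "s \<le> R" for s
  proof -
    have "(s - R) * (2 * r) \<le> 0" using that rR by (simp add: mult_nonpos_nonneg)
    then have "l s \<le> s" using rR by (simp add: l_def field_simps)
    moreover have "l s \<ge> - r" using that rR by (simp add: l_def)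
    ultimately have "l s / s \<le> 1" "l s / s \<ge> -1" using that rR by (auto simp: field_simps)
    then have "\<theta> s = arccos (l s / s)" using that by (simp add: \<theta>_def max_def min_def)
    then show ?thesis using \<open>l s / s \<le> 1\<close> \<open>l s / s \<ge> -1\<close> that rR by simp
  qed
  have cont_\<theta>: "continuous_on UNIV \<theta>"
    unfolding \<theta>_def l_def using rR by (intro continuous_intros) (auto simp: max_def)
  have normT: "cmod (T z - of_real c) = cmod (z - of_real c)" for z
    by (simp add: T_def norm_mult)
  have memball: "z \<in> diam_ball u v \<longleftrightarrow> cmod (z - of_real c) < (v - u) / 2" if "(u + v) / 2 = c" for z u v
    by (simp add: diam_ball_def dist_norm norm_minus_commute that del: of_real_divide of_real_add)
  show "disc_homeo a b T"
    unfolding disc_homeo_def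
  proof (intro conjI allI impI)
    show "continuous_on UNIV T"
      unfolding T_def by (intro continuous_intros continuous_on_compose2[OF cont_\<theta>]) auto
    show "inj T"
    proof (rule injI)
      fix z w assume eq: "T z = T w"
      then have n: "cmod (z - of_real c) = cmod (w - of_real c)" using normT[of z] normT[of w] by simp
      then show "z = w" using eq by (simp add: T_def)
    qed
    show "T z = z" if "z \<notin> diam_ball a b" for z
      using that \<theta>_large[of "cmod (z - of_real c)"] memball[of a b z]
      by (simp add: T_def c_def R_def)
  qed
  have T_small: "T z = of_real (a + b) - z" if "cmod (z - of_real c) \<le> r" for z
  proof -
    have "of_real (a + b) = 2 * complex_of_real c" by (simp add: c_def)
    then show ?thesis using \<theta>_small[OF that] by (simp add: T_def)
  qed
  show "T z = of_real (a + b) - z" if "z \<in> diam_ball a' b'" for z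
    using that memball[of a' b' z] assms by (intro T_small) (simp add: c_def r_def)
  have "cmod (of_real a' - of_real c) = r" "cmod (of_real b' - of_real c) = r"
    unfolding of_real_diff[symmetric] norm_of_real using rR ab by auto
  then show "T (of_real a') = of_real b'" "T (of_real b') = of_real a'"
    using T_small[of "of_real a'"] T_small[of "of_real b'"] assms(3)
    by (auto simp del: of_real_add simp flip: of_real_diff)
  have T_left: "T (of_real (c - s)) = of_real c - of_real s * cis (\<theta> s)" if "s \<ge> 0" for s
    using that by (simp add: T_def)
  have T_right: "T (of_real (c + s)) = of_real c + of_real s * cis (\<theta> s)" if "s \<ge> 0" for s
    using that by (simp add: T_def)
  have sin: "sin (\<theta> s) \<ge> 0" for s using \<theta>_range by (intro sin_ge_zero)
  show "Im (T (of_real x)) \<le> 0" if "x \<in> {a..a'}" for x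
    using T_left[of "c - x"] sin[of "c - x"] that rR ab by auto
  show "Im (T (of_real x)) \<ge> 0" if "x \<in> {b'..b}" for x
    using T_right[of "x - c"] sin[of "x - c"] that rR ab by auto
  have "Re (T (of_real x)) = c - l (c - x)" if "x \<in> {a..a'}" for x
    using T_left[of "c - x"] s_cos[of "c - x"] that rR ab by auto
  then show "inj_on (\<lambda>x. Re (T (of_real x))) {a..a'}"
    using rR by (auto simp: inj_on_def l_def)
  have "Re (T (of_real x)) = c + l (x - c)" if "x \<in> {b'..b}" for x
    using T_right[of "x - c"] s_cos[of "x - c"] that rR ab by auto
  then show "inj_on (\<lambda>x. Re (T (of_real x))) {b'..b}"
    using rR by (auto simp: inj_on_def l_def)
qed

section \<open>Realizing prescribed twist numbers\<close>

definition crossings :: "(complex \<Rightarrow> complex) \<Rightarrow> real \<Rightarrow> real \<Rightarrow> real \<Rightarrow> real set" where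
  "crossings h a b m = {x\<in>{a..b}. Re (h (of_real x)) = m}"

text \<open>The points \<open>q i\<close> need only have preimages on the diameter: this is stable
  under half twists, whereas invariance of the set of all \<open>q i\<close> is not. For crossings
  an upper bound suffices, since the twists force the lower one.\<close>

definition realizes ::
    "(complex \<Rightarrow> complex) \<Rightarrow> real \<Rightarrow> real \<Rightarrow> nat \<Rightarrow> (nat \<Rightarrow> real) \<Rightarrow> (nat \<Rightarrow> nat) \<Rightarrow> bool" where
  "realizes h a b n q k \<longleftrightarrow> disc_homeo a b h \<and>
     (\<forall>i\<in>{1..n}. \<exists>x. a < x \<and> x < b \<and> h (of_real x) = of_real (q i)) \<and>
     (\<forall>j\<in>{1..<n}. pair_twist h a b (q j) (q (j + 1)) (k j) \<and>
        finite (crossings h a b ((q j + q (j + 1)) / 2)) \<and>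
        card (crossings h a b ((q j + q (j + 1)) / 2)) \<le> 2 * k j + 1)"

lemma disc_homeo_cont: "disc_homeo a b h \<Longrightarrow> continuous_on S h"
  by (auto simp: disc_homeo_def intro: continuous_on_subset)

lemma disc_homeo_path: "disc_homeo a b h \<Longrightarrow> path (h \<circ> linepath x y)"
  by (intro path_continuous_image disc_homeo_cont) auto

lemma disc_homeo_eq: "disc_homeo a b h \<Longrightarrow> h z = h w \<longleftrightarrow> z = w"
  by (auto simp: disc_homeo_def inj_eq)

lemma of_real_in_closed_segment:
  "complex_of_real x \<in> closed_segment (of_real a) (of_real b) \<longleftrightarrow> x \<in> closed_segment a b"
  unfolding closed_segment_of_real by (auto simp: image_iff)

lemma disc_homeo_notin_segment:
  "disc_homeo a b h \<Longrightarrow> t \<notin> closed_segment x y \<Longrightarrow>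
    h (of_real t) \<notin> h ` closed_segment (of_real x) (of_real y)"
  by (auto simp: disc_homeo_eq of_real_in_closed_segment)

lemma linepath_of_real_ext:
  "linepath (complex_of_real a) (of_real b) = (\<lambda>x. of_real (linepath a b x))"
  by (rule ext) (simp add: linepath_def scaleR_conv_of_real)

lemma linepath_in_Icc:
  fixes a b :: real
  shows "\<tau> \<in> {0..1} \<Longrightarrow> linepath a b \<tau> \<in> {min a b..max a b}"
  using linepath_in_path[of \<tau> a b] by (auto simp: closed_segment_eq_real_ivl split: if_splits)

text \<open>The disks over \<open>[a, m]\<close> and \<open>[m, b]\<close> lie on different sides of
  the line at \<open>m\<close>, and each factor moves points only on its own side. So neither half
  adds crossings with lines of the other half or turns about its punctures.\<close>

lemma realizes_split:
  assumes l: "realizes hl a m j0 q k" and r: "realizes hr m b (n - j0) (\<lambda>i. q (j0 + i)) (\<lambda>i. k (j0 + i))"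
    and j0: "1 \<le> j0" "j0 < n" "k j0 = 0" and amb: "a < m" "m < b"
    and m: "m = (q j0 + q (j0 + 1)) / 2"
    and q: "\<And>i. i \<in> {1..j0} \<Longrightarrow> a < q i \<and> q i < m" "\<And>i. i \<in> {j0<..n} \<Longrightarrow> m < q i \<and> q i < b"
  shows "realizes (hl \<circ> hr) a b n q k"
proof -
  define h where "h = hl \<circ> hr"
  have dl: "disc_homeo a m hl" and dr: "disc_homeo m b hr"
    using l r by (auto simp: realizes_def)
  have dh: "disc_homeo a b h"
    unfolding h_def using dl dr amb by (intro disc_homeo_compose; auto intro: disc_homeo_mono)
  have h_left: "h z = hl z" if "Re z \<le> m" for z
  proof -
    have "z \<notin> diam_ball m b" using that diam_ball_Re by fastforce
    then show ?thesis by (simp add: h_def disc_homeo_fix[OF dr])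
  qed
  have h_right: "h z = hr z" "Re (hr z) \<ge> m" if "Re z \<ge> m" for z
  proof -
    show "Re (hr z) \<ge> m"
      using that disc_homeo_fix[OF dr, of z] disc_homeo_maps[OF dr, of z] diam_ball_Re[of "hr z" m b]
      by (cases "z \<in> diam_ball m b") auto
    then have "hr z \<notin> diam_ball a m" using diam_ball_Re by fastforce
    then show "h z = hr z" by (simp add: h_def disc_homeo_fix[OF dl])
  qed
  have hl_le: "Re (hl z) \<le> m" if "Re z \<le> m" for z
    using that disc_homeo_fix[OF dl, of z] disc_homeo_maps[OF dl, of z] diam_ball_Re[of "hl z" a m]
    by (cases "z \<in> diam_ball a m") auto
  have hfix: "h (of_real a) = of_real a" "h (of_real b) = of_real b" "h (of_real m) = of_real m"
    using disc_homeo_fix[OF dl, of "of_real a"] disc_homeo_fix[OF dr, of "of_real b"]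
      disc_homeo_fix[OF dl, of "of_real m"] h_left[of "of_real m"] h_left[of "of_real a"]
      h_right(1)[of "of_real b"] amb by auto
  have wl: "winding_number (h \<circ> linepath (of_real x) (of_real y)) w
      = winding_number (hl \<circ> linepath (of_real x) (of_real y)) w" if "x \<le> m" "y \<le> m" for x y w
    by (rule winding_number_cong)
      (use that linepath_in_Icc[of _ x y] in \<open>fastforce simp: linepath_of_real_ext intro: h_left\<close>)
  have wr: "winding_number (h \<circ> linepath (of_real x) (of_real y)) w
      = winding_number (hr \<circ> linepath (of_real x) (of_real y)) w" if "x \<ge> m" "y \<ge> m" for x y w
    by (rule winding_number_cong)
      (use that linepath_in_Icc[of _ x y] in \<open>fastforce simp: linepath_of_real_ext intro: h_right\<close>)
  have w0_left: "Re (winding_number (h \<circ> linepath (of_real x) (of_real y)) (of_real w)) = 0"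
    if "x \<le> m" "y \<le> m" "w > m" "h (of_real x) = of_real x'" "h (of_real y) = of_real y'" for x y w x' y'
  proof (rule Re_winding_half_plane[where e = "-1"])
    fix \<tau> :: real assume "\<tau> \<in> {0..1}"
    then have "linepath x y \<tau> \<le> m" using linepath_in_Icc[of \<tau> x y] that by auto
    then show "- 1 * w < - 1 * Re ((h \<circ> linepath (of_real x) (of_real y)) \<tau>)"
      using hl_le[of "of_real (linepath x y \<tau>)"] h_left[of "of_real (linepath x y \<tau>)"] that
      by (simp add: linepath_of_real_ext)
  qed (use that disc_homeo_path[OF dh] in \<open>auto simp: linepath_0' linepath_1'\<close>)
  have w0_right: "Re (winding_number (h \<circ> linepath (of_real x) (of_real y)) (of_real w)) = 0"
    if "x \<ge> m" "y \<ge> m" "w < m" "h (of_real x) = of_real x'" "h (of_real y) = of_real y'" for x y w x' y'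
  proof (rule Re_winding_half_plane[where e = "1"])
    fix \<tau> :: real assume "\<tau> \<in> {0..1}"
    then have "linepath x y \<tau> \<ge> m" using linepath_in_Icc[of \<tau> x y] that by auto
    then show "1 * w < 1 * Re ((h \<circ> linepath (of_real x) (of_real y)) \<tau>)"
      using h_right[of "of_real (linepath x y \<tau>)"] that by (simp add: linepath_of_real_ext)
  qed (use that disc_homeo_path[OF dh] in \<open>auto simp: linepath_0' linepath_1'\<close>)
  have preim_l: "\<exists>x. a < x \<and> x < m \<and> h (of_real x) = of_real (q i)" if i: "i \<in> {1..j0}" for i
  proof -
    obtain x where "a < x" "x < m" "hl (of_real x) = of_real (q i)"
      using l i unfolding realizes_def by blast
    then show ?thesis using h_left[of "of_real x"] by auto
  qed
  have preim_r: "\<exists>x. m < x \<and> x < b \<and> h (of_real x) = of_real (q i)" if i: "i \<in> {j0<..n}" for i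
  proof -
    have "i - j0 \<in> {1..n - j0}" using i by auto
    then have "\<exists>x. m < x \<and> x < b \<and> hr (of_real x) = of_real (q (j0 + (i - j0)))"
      using r unfolding realizes_def by blast
    then obtain x where "m < x" "x < b" "hr (of_real x) = of_real (q i)" using i by auto
    then show ?thesis using h_right[of "of_real x"] by auto
  qed
  have "realizes h a b n q k"
    unfolding realizes_def
  proof (intro conjI ballI)
    fix i assume i: "i \<in> {1..n}"
    show "\<exists>x. a < x \<and> x < b \<and> h (of_real x) = of_real (q i)"
    proof (cases "i \<le> j0")
      case True
      then obtain x where "a < x" "x < m" "h (of_real x) = of_real (q i)"
        using preim_l[of i] i by auto
      then show ?thesis using amb by (intro exI[of _ x]) auto
    next
      case False
      then obtain x where "m < x" "x < b" "h (of_real x) = of_real (q i)"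
        using preim_r[of i] i by auto
      then show ?thesis using amb by (intro exI[of _ x]) auto
    qed
  next
    fix j assume j: "j \<in> {1..<n}"
    consider "j < j0" | "j = j0" | "j0 < j" by linarith
    then have "pair_twist h a b (q j) (q (j + 1)) (k j) \<and>
        finite (crossings h a b ((q j + q (j + 1)) / 2)) \<and>
        card (crossings h a b ((q j + q (j + 1)) / 2)) \<le> 2 * k j + 1"
    proof cases
      case 1
      then have "j \<in> {1..<j0}" using j by simp
      then have tw: "pair_twist hl a m (q j) (q (j + 1)) (k j)"
        and fin: "finite (crossings hl a m ((q j + q (j + 1)) / 2))"
        and card: "card (crossings hl a m ((q j + q (j + 1)) / 2)) \<le> 2 * k j + 1"
        using l unfolding realizes_def by blast+
      have qj: "q j < m" "q (j + 1) < m" using q(1)[of j] q(1)[of "j + 1"] 1 j by auto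
      obtain s t where st: "a < s" "s < t" "t < m"
        and im: "{hl (of_real s), hl (of_real t)} = {of_real (q j), of_real (q (j + 1))}"
        and w1: "2 * Re (winding_number (hl \<circ> linepath (of_real a) (of_real s)) (hl (of_real t))) = k j"
        and w2: "2 * Re (winding_number (hl \<circ> linepath (of_real m) (of_real t)) (hl (of_real s))) = k j"
        using tw by (auto simp: pair_twist_def)
      have hst: "h (of_real s) = hl (of_real s)" "h (of_real t) = hl (of_real t)"
        using st by (auto intro: h_left)
      obtain u where u: "hl (of_real s) = of_real u" "u < m"
        using im qj by (auto simp: doubleton_eq_iff)
      \<comment> \<open>The right end arc now starts at \<open>b\<close> instead of
        \<open>m\<close>. The additional piece from \<open>b\<close> to \<open>m\<close> stays in
        the right half-plane and makes no turn about a point left of the line.\<close>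
      have "winding_number (h \<circ> linepath (of_real b) (of_real t)) (h (of_real s)) =
          winding_number (h \<circ> linepath (of_real b) (of_real m)) (h (of_real s)) +
          winding_number (h \<circ> linepath (of_real m) (of_real t)) (h (of_real s))"
        using st amb
        by (intro winding_compose_linepath_split disc_homeo_cont[OF dh] disc_homeo_notin_segment[OF dh])
          (auto simp: of_real_in_closed_segment closed_segment_eq_real_ivl)
      moreover have "Re (winding_number (h \<circ> linepath (of_real b) (of_real m)) (h (of_real s))) = 0"
        unfolding hst u using u amb hfix by (intro w0_right) auto
      ultimately have "2 * Re (winding_number (h \<circ> linepath (of_real b) (of_real t)) (h (of_real s))) = k j"
        using w2 st by (simp add: wl hst)
      moreover have "2 * Re (winding_number (h \<circ> linepath (of_real a) (of_real s)) (h (of_real t))) = k j"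
        using w1 st by (simp add: wl hst)
      ultimately have "pair_twist h a b (q j) (q (j + 1)) (k j)"
        unfolding pair_twist_def using st im amb hst by (intro exI[of _ s] exI[of _ t]) auto
      moreover have "crossings h a b ((q j + q (j + 1)) / 2) \<subseteq> crossings hl a m ((q j + q (j + 1)) / 2)"
      proof
        fix x assume x: "x \<in> crossings h a b ((q j + q (j + 1)) / 2)"
        then have "x \<le> m" using h_right[of "of_real x"] qj by (fastforce simp: crossings_def)
        then show "x \<in> crossings hl a m ((q j + q (j + 1)) / 2)"
          using x h_left[of "of_real x"] by (simp add: crossings_def)
      qed
      ultimately show ?thesis using fin card card_mono finite_subset order_trans by meson
    next
      case 3
      define i where "i = j - j0"
      have ij: "j0 + i = j" using 3 by (simp add: i_def)
      have "i \<in> {1..<n - j0}" using j 3 by (auto simp: i_def)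
      then have "pair_twist hr m b (q (j0 + i)) (q (j0 + (i + 1))) (k (j0 + i))"
        and "finite (crossings hr m b ((q (j0 + i) + q (j0 + (i + 1))) / 2))"
        and "card (crossings hr m b ((q (j0 + i) + q (j0 + (i + 1))) / 2)) \<le> 2 * k (j0 + i) + 1"
        using r unfolding realizes_def by blast+
      then have tw: "pair_twist hr m b (q j) (q (j + 1)) (k j)"
        and fin: "finite (crossings hr m b ((q j + q (j + 1)) / 2))"
        and card: "card (crossings hr m b ((q j + q (j + 1)) / 2)) \<le> 2 * k j + 1"
        using ij by (simp_all flip: add.assoc)
      have qj: "m < q j" "m < q (j + 1)" using q(2)[of j] q(2)[of "j + 1"] 3 j by auto
      obtain s t where st: "m < s" "s < t" "t < b"
        and im: "{hr (of_real s), hr (of_real t)} = {of_real (q j), of_real (q (j + 1))}"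
        and w1: "2 * Re (winding_number (hr \<circ> linepath (of_real m) (of_real s)) (hr (of_real t))) = k j"
        and w2: "2 * Re (winding_number (hr \<circ> linepath (of_real b) (of_real t)) (hr (of_real s))) = k j"
        using tw by (auto simp: pair_twist_def)
      have hst: "h (of_real s) = hr (of_real s)" "h (of_real t) = hr (of_real t)"
        using st by (auto intro: h_right)
      obtain u where u: "hr (of_real t) = of_real u" "m < u"
        using im qj by (auto simp: doubleton_eq_iff)
      have "winding_number (h \<circ> linepath (of_real a) (of_real s)) (h (of_real t)) =
          winding_number (h \<circ> linepath (of_real a) (of_real m)) (h (of_real t)) +
          winding_number (h \<circ> linepath (of_real m) (of_real s)) (h (of_real t))"
        using st amb
        by (intro winding_compose_linepath_split disc_homeo_cont[OF dh] disc_homeo_notin_segment[OF dh])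
          (auto simp: of_real_in_closed_segment closed_segment_eq_real_ivl)
      moreover have "Re (winding_number (h \<circ> linepath (of_real a) (of_real m)) (h (of_real t))) = 0"
        unfolding hst u using u amb hfix by (intro w0_left) auto
      ultimately have "2 * Re (winding_number (h \<circ> linepath (of_real a) (of_real s)) (h (of_real t))) = k j"
        using w1 st by (simp add: wr hst)
      moreover have "2 * Re (winding_number (h \<circ> linepath (of_real b) (of_real t)) (h (of_real s))) = k j"
        using w2 st by (simp add: wr hst)
      ultimately have "pair_twist h a b (q j) (q (j + 1)) (k j)"
        unfolding pair_twist_def using st im amb hst by (intro exI[of _ s] exI[of _ t]) auto
      moreover have "crossings h a b ((q j + q (j + 1)) / 2) \<subseteq> crossings hr m b ((q j + q (j + 1)) / 2)"
      proof
        fix x assume x: "x \<in> crossings h a b ((q j + q (j + 1)) / 2)"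
        then have "x \<ge> m"
          using h_left[of "of_real x"] hl_le[of "of_real x"] qj by (fastforce simp: crossings_def)
        then show "x \<in> crossings hr m b ((q j + q (j + 1)) / 2)"
          using x h_right[of "of_real x"] by (simp add: crossings_def)
      qed
      ultimately show ?thesis using fin card card_mono finite_subset order_trans by meson
    next
      case 2
      obtain s where s: "a < s" "s < m" "h (of_real s) = of_real (q j0)" using preim_l[of j0] j0 by auto
      obtain t where t: "m < t" "t < b" "h (of_real t) = of_real (q (j0 + 1))"
        using preim_r[of "j0 + 1"] j0 by auto
      have qm: "q j0 < m" "m < q (j0 + 1)" using q(1)[of j0] q(2)[of "j0 + 1"] j0 by auto
      have "Re (winding_number (h \<circ> linepath (of_real a) (of_real s)) (h (of_real t))) = 0"
        unfolding t(3) using s t hfix amb qm by (intro w0_left[of _ _ _ a "q j0"]) auto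
      moreover have "Re (winding_number (h \<circ> linepath (of_real b) (of_real t)) (h (of_real s))) = 0"
        unfolding s(3) using s t hfix amb qm by (intro w0_right[of _ _ _ b "q (j0 + 1)"]) auto
      ultimately have "pair_twist h a b (q j0) (q (j0 + 1)) (k j0)"
        unfolding pair_twist_def using s t j0 by (intro exI[of _ s] exI[of _ t]) auto
      \<comment> \<open>Both factors keep the open half-planes on either side of the line, so the
        diameter meets it only at the fixed point \<open>m\<close>.\<close>
      moreover have "crossings h a b m \<subseteq> {m}"
      proof
        fix x assume x: "x \<in> crossings h a b m"
        have "Re (hl (of_real x)) < m" if "x < m"
          using that diam_ball_Re[of "hl (of_real x)" a m] disc_homeo_maps[OF dl, of "of_real x"]
            disc_homeo_fix[OF dl, of "of_real x"] by (cases "a < x") auto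
        moreover have "Re (hr (of_real x)) > m" if "x > m"
          using that diam_ball_Re[of "hr (of_real x)" m b] disc_homeo_maps[OF dr, of "of_real x"]
            disc_homeo_fix[OF dr, of "of_real x"] by (cases "x < b") auto
        ultimately show "x \<in> {m}"
          using x h_left[of "of_real x"] h_right[of "of_real x"]
          by (cases x m rule: linorder_cases) (auto simp: crossings_def)
      qed
      then have "finite (crossings h a b m)" "card (crossings h a b m) \<le> 1"
        using card_mono[of "{m}" "crossings h a b m"] by (auto intro: finite_subset)
      ultimately show ?thesis using 2 m by simp
    qed
    then show "pair_twist h a b (q j) (q (j + 1)) (k j)"
        "finite (crossings h a b ((q j + q (j + 1)) / 2))"
        "card (crossings h a b ((q j + q (j + 1)) / 2)) \<le> 2 * k j + 1" by auto
  qed (rule dh)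
  then show ?thesis by (simp add: h_def)
qed

text \<open>The outermost half twist reverses the order of the punctures, so that \<open>g\<close> has to realize the
  reflected configuration.\<close>

lemma realizes_twist:
  assumes g: "realizes g a' b' n (\<lambda>i. a + b - q (n + 1 - i)) (\<lambda>i. k (n - i) - 1)"
    and ab: "a < a'" "a' < b'" "a' + b' = a + b"
    and q: "\<And>i. i \<in> {1..n} \<Longrightarrow> a' < q i \<and> q i < b'"
    and k: "\<And>j. j \<in> {1..<n} \<Longrightarrow> 1 \<le> k j"
  obtains h where "realizes h a b n q k"
proof -
  obtain T where dT: "disc_homeo a b T"
    and T_in: "\<And>z. z \<in> diam_ball a' b' \<Longrightarrow> T z = of_real (a + b) - z"
    and T_ends: "T (of_real a') = of_real b'" "T (of_real b') = of_real a'"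
    and T_low: "\<And>x. x \<in> {a..a'} \<Longrightarrow> Im (T (of_real x)) \<le> 0"
    and T_up: "\<And>x. x \<in> {b'..b} \<Longrightarrow> Im (T (of_real x)) \<ge> 0"
    and T_inj: "inj_on (\<lambda>x. Re (T (of_real x))) {a..a'}" "inj_on (\<lambda>x. Re (T (of_real x))) {b'..b}"
    by (rule half_twist[OF ab]) (rule that)
  define h where "h = T \<circ> g"
  have dg: "disc_homeo a' b' g" using g by (simp add: realizes_def)
  have "b' < b" using ab by simp
  have dh: "disc_homeo a b h"
    unfolding h_def using dT dg ab by (intro disc_homeo_compose; auto intro: disc_homeo_mono)
  have h_in: "h (of_real x) = of_real (a + b) - g (of_real x)" if "a' \<le> x" "x \<le> b'" for x
  proof (cases "a' < x \<and> x < b'")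
    case True
    then show ?thesis using disc_homeo_maps[OF dg, of "of_real x"] T_in by (simp add: h_def)
  next
    case False
    then have "x = a' \<or> x = b'" using that by auto
    moreover have "complex_of_real (a + b) - of_real a' = of_real b'" "complex_of_real (a + b) - of_real b' = of_real a'"
      unfolding ab(3)[symmetric] by simp_all
    ultimately show ?thesis
      using T_ends disc_homeo_fix[OF dg, of "of_real x"] by (auto simp: h_def simp del: of_real_add)
  qed
  have h_out: "h (of_real x) = T (of_real x)" if "x \<le> a' \<or> b' \<le> x" for x
    using that disc_homeo_fix[OF dg, of "of_real x"] by (auto simp: h_def)
  have h_ab: "h (of_real a) = of_real a" "h (of_real b) = of_real b"
    by (simp_all add: disc_homeo_fix[OF dh])
  have w_in: "winding_number (h \<circ> linepath (of_real x) (of_real y)) (h (of_real t)) =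
      winding_number (g \<circ> linepath (of_real x) (of_real y)) (g (of_real t))"
    if "x \<in> {a'..b'}" "y \<in> {a'..b'}" "t \<in> {a'..b'}" "t \<notin> closed_segment x y" for x y t
  proof -
    have "winding_number (h \<circ> linepath (of_real x) (of_real y)) (h (of_real t)) =
        winding_number (\<lambda>\<tau>. of_real (a + b) - (g \<circ> linepath (of_real x) (of_real y)) \<tau>)
          (of_real (a + b) - g (of_real t))"
      using h_in[of t] that(3)
    proof (simp only: atLeastAtMost_iff, intro winding_number_cong)
      fix \<tau> :: real assume "0 \<le> \<tau>" "\<tau> \<le> 1"
      then have "linepath x y \<tau> \<in> {a'..b'}"
        using linepath_in_Icc[of \<tau> x y] that by (auto simp: min_def max_def split: if_splits)
      then show "(h \<circ> linepath (of_real x) (of_real y)) \<tau> =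
          of_real (a + b) - (g \<circ> linepath (of_real x) (of_real y)) \<tau>"
        using h_in[of "linepath x y \<tau>"] by (simp add: linepath_of_real_ext)
    qed
    also have "\<dots> = winding_number (g \<circ> linepath (of_real x) (of_real y)) (g (of_real t))"
      using disc_homeo_notin_segment[OF dg that(4)]
        winding_number_reflect[OF disc_homeo_path[OF dg, of "of_real x" "of_real y"], of "g (of_real t)"]
      by (simp only: path_image_compose path_image_linepath not_False_eq_True simp_thms)
    finally show ?thesis .
  qed
  have "realizes h a b n q k"
    unfolding realizes_def
  proof (intro conjI ballI)
    fix i assume i: "i \<in> {1..n}"
    then have "n + 1 - i \<in> {1..n}" by auto
    then obtain x where x: "a' < x" "x < b'" "g (of_real x) = of_real (a + b - q (n + 1 - (n + 1 - i)))"
      using g unfolding realizes_def by blast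
    then have "h (of_real x) = of_real (q i)"
      using h_in[of x] i by simp
    then show "\<exists>x. a < x \<and> x < b \<and> h (of_real x) = of_real (q i)"
      using x ab \<open>b' < b\<close> by (intro exI[of _ x]) auto
  next
    fix j assume j: "j \<in> {1..<n}"
    \<comment> \<open>The reflection reverses the gaps as well: the gap after puncture
      \<open>j\<close> is number \<open>n - j\<close> in the configuration of
      \<open>g\<close>.\<close>
    define i where "i = n - j"
    have ij: "i \<in> {1..<n}" "n - i = j" "n + 1 - i = j + 1" "n + 1 - (i + 1) = j"
      using j by (auto simp: i_def)
    define m where "m = (q j + q (j + 1)) / 2"
    have "pair_twist g a' b' (a + b - q (n + 1 - i)) (a + b - q (n + 1 - (i + 1))) (k (n - i) - 1)"
      and "finite (crossings g a' b' ((a + b - q (n + 1 - i) + (a + b - q (n + 1 - (i + 1)))) / 2))"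
      and "card (crossings g a' b' ((a + b - q (n + 1 - i) + (a + b - q (n + 1 - (i + 1)))) / 2)) \<le> 2 * (k (n - i) - 1) + 1"
      using g ij(1) unfolding realizes_def by blast+
    moreover have "(a + b - q (j + 1) + (a + b - q j)) / 2 = a + b - m"
      by (simp add: m_def field_simps)
    ultimately have tw: "pair_twist g a' b' (a + b - q (j + 1)) (a + b - q j) (k j - 1)"
      and fin: "finite (crossings g a' b' (a + b - m))"
      and card: "card (crossings g a' b' (a + b - m)) \<le> 2 * (k j - 1) + 1"
      by (simp_all only: ij)
    obtain s t where st: "a' < s" "s < t" "t < b'"
      and im: "{g (of_real s), g (of_real t)} = {of_real (a + b - q (j + 1)), of_real (a + b - q j)}"
      and w1: "2 * Re (winding_number (g \<circ> linepath (of_real a') (of_real s)) (g (of_real t))) = real (k j - 1)"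
      and w2: "2 * Re (winding_number (g \<circ> linepath (of_real b') (of_real t)) (g (of_real s))) = real (k j - 1)"
      using tw unfolding pair_twist_def by blast
    have him: "{h (of_real s), h (of_real t)} = {of_real (q j), of_real (q (j + 1))}"
      using im st h_in[of s] h_in[of t] by (auto simp: doubleton_eq_iff)
    then obtain u v where uv: "h (of_real s) = of_real u" "h (of_real t) = of_real v"
      "a' < u" "u < b'" "a' < v" "v < b'"
      using q[of j] q[of "j + 1"] j by (auto simp: doubleton_eq_iff)
    have hne: "h (of_real x) \<noteq> h (of_real y)" if "x \<noteq> y" for x y
      using that by (simp add: disc_homeo_eq[OF dh])
    \<comment> \<open>The spiral from \<open>a\<close> to \<open>a'\<close> supplies the half turn
      that raises \<open>k j - 1\<close> to \<open>k j\<close>. The rest of the end arc is a point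
      reflection of that of \<open>g\<close> and turns equally often.\<close>
    have "Re (winding_number (h \<circ> linepath (of_real a) (of_real a')) (of_real v)) = 1 / 2"
    proof (rule Re_winding_lower_half[where x = a and y = b'])
      fix \<tau> :: real assume "\<tau> \<in> {0..1}"
      then have "linepath a a' \<tau> \<in> {a..a'}"
        using linepath_in_Icc[of \<tau> a a'] ab by auto
      then show "Im ((h \<circ> linepath (of_real a) (of_real a')) \<tau>) \<le> 0 \<and>
          (h \<circ> linepath (of_real a) (of_real a')) \<tau> \<noteq> of_real v"
        using hne[of "linepath a a' \<tau>" t] st uv T_low[of "linepath a a' \<tau>"] h_out[of "linepath a a' \<tau>"]
        by (auto simp: linepath_of_real_ext)
    qed (use disc_homeo_path[OF dh] h_ab h_out[of a'] T_ends uv ab in \<open>auto simp: linepath_0' linepath_1'\<close>)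
    moreover have "winding_number (h \<circ> linepath (of_real a) (of_real s)) (h (of_real t)) =
        winding_number (h \<circ> linepath (of_real a) (of_real a')) (h (of_real t)) +
        winding_number (h \<circ> linepath (of_real a') (of_real s)) (h (of_real t))"
      using st ab
      by (intro winding_compose_linepath_split disc_homeo_cont[OF dh] disc_homeo_notin_segment[OF dh])
        (auto simp: of_real_in_closed_segment closed_segment_eq_real_ivl)
    moreover have "winding_number (h \<circ> linepath (of_real a') (of_real s)) (h (of_real t)) =
        winding_number (g \<circ> linepath (of_real a') (of_real s)) (g (of_real t))"
      using st by (intro w_in) (auto simp: closed_segment_eq_real_ivl)
    ultimately have "2 * Re (winding_number (h \<circ> linepath (of_real a) (of_real s)) (h (of_real t))) = k j"
      using w1 k[OF j] uv by (simp add: of_nat_diff)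
    moreover
    have "Re (winding_number (h \<circ> linepath (of_real b) (of_real b')) (of_real u)) = 1 / 2"
    proof (rule Re_winding_upper_half[where x = b and y = a'])
      fix \<tau> :: real assume "\<tau> \<in> {0..1}"
      then have "linepath b b' \<tau> \<in> {b'..b}"
        using linepath_in_Icc[of \<tau> b b'] \<open>b' < b\<close> by auto
      then show "0 \<le> Im ((h \<circ> linepath (of_real b) (of_real b')) \<tau>) \<and>
          (h \<circ> linepath (of_real b) (of_real b')) \<tau> \<noteq> of_real u"
        using hne[of "linepath b b' \<tau>" s] st uv T_up[of "linepath b b' \<tau>"] h_out[of "linepath b b' \<tau>"]
        by (auto simp: linepath_of_real_ext)
    qed (use disc_homeo_path[OF dh] h_ab h_out[of b'] T_ends uv \<open>b' < b\<close> in \<open>auto simp: linepath_0' linepath_1'\<close>)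
    moreover have "winding_number (h \<circ> linepath (of_real b) (of_real t)) (h (of_real s)) =
        winding_number (h \<circ> linepath (of_real b) (of_real b')) (h (of_real s)) +
        winding_number (h \<circ> linepath (of_real b') (of_real t)) (h (of_real s))"
      using st \<open>b' < b\<close>
      by (intro winding_compose_linepath_split disc_homeo_cont[OF dh] disc_homeo_notin_segment[OF dh])
        (auto simp: of_real_in_closed_segment closed_segment_eq_real_ivl)
    moreover have "winding_number (h \<circ> linepath (of_real b') (of_real t)) (h (of_real s)) =
        winding_number (g \<circ> linepath (of_real b') (of_real t)) (g (of_real s))"
      using st by (intro w_in) (auto simp: closed_segment_eq_real_ivl)
    ultimately have "2 * Re (winding_number (h \<circ> linepath (of_real b) (of_real t)) (h (of_real s))) = k j"
        "2 * Re (winding_number (h \<circ> linepath (of_real a) (of_real s)) (h (of_real t))) = k j"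
      using w2 k[OF j] uv by (simp_all add: of_nat_diff)
    then show "pair_twist h a b (q j) (q (j + 1)) (k j)"
      unfolding pair_twist_def using st him ab \<open>b' < b\<close> by (intro exI[of _ s] exI[of _ t]) auto
    \<comment> \<open>\<open>A\<close> and \<open>B\<close> are the crossings of the two spirals, at
      most one each; together with the \<open>2 * (k j - 1) + 1\<close> crossings of
      \<open>g\<close> they give \<open>2 * k j + 1\<close>.\<close>
    define A where "A = {x\<in>{a..a'}. Re (T (of_real x)) = m}"
    define B where "B = {x\<in>{b'..b}. Re (T (of_real x)) = m}"
    have small: "finite S \<and> card S \<le> 1" if eq: "\<And>x y. x \<in> S \<Longrightarrow> y \<in> S \<Longrightarrow> x = y" for S :: "real set"
    proof (cases "S = {}")
      case False
      then obtain x where "S = {x}" using eq by blast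
      then show ?thesis by simp
    qed simp
    have A: "finite A \<and> card A \<le> 1"
      using T_inj(1) by (intro small) (auto simp: A_def inj_on_def)
    have B: "finite B \<and> card B \<le> 1"
      using T_inj(2) by (intro small) (auto simp: B_def inj_on_def)
    have sub: "crossings h a b m \<subseteq> A \<union> B \<union> crossings g a' b' (a + b - m)"
    proof
      fix x assume x: "x \<in> crossings h a b m"
      consider "x \<le> a'" | "b' \<le> x" | "a' \<le> x" "x \<le> b'" by linarith
      then show "x \<in> A \<union> B \<union> crossings g a' b' (a + b - m)"
        using x h_out[of x] h_in[of x] by cases (auto simp: A_def B_def crossings_def)
    qed
    have finU: "finite (A \<union> B \<union> crossings g a' b' (a + b - m))" using A B fin by simp
    show "finite (crossings h a b ((q j + q (j + 1)) / 2))"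
      using finite_subset[OF sub finU] by (simp add: m_def)
    have "card (crossings h a b m) \<le> card (A \<union> B \<union> crossings g a' b' (a + b - m))"
      using finU sub by (rule card_mono)
    also have "\<dots> \<le> card A + card B + card (crossings g a' b' (a + b - m))"
      using card_Un_le[of "A \<union> B" "crossings g a' b' (a + b - m)"] card_Un_le[of A B] by linarith
    also have "\<dots> \<le> 2 * k j + 1" using A B card k[OF j] by linarith
    finally show "card (crossings h a b ((q j + q (j + 1)) / 2)) \<le> 2 * k j + 1" by (simp add: m_def)
  qed (rule dh)
  then show ?thesis by (rule that)
qed

text \<open>If some gap has twist number 0, the disk is split there and both parts have fewer
  punctures. Otherwise one half twist around all punctures is peeled off, which lowers every twist
  number by 1. The measure \<open>n + sum k {1..<n}\<close> decreases in both cases.\<close>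

lemma realizes_exists:
  assumes "1 \<le> n" "strict_mono_on {1..n} q" "\<And>i. i \<in> {1..n} \<Longrightarrow> a < q i \<and> q i < b"
  shows "\<exists>h. realizes h a b n q k"
  using assms
proof (induction "n + sum k {1..<n}" arbitrary: n q k a b rule: less_induct)
  case less
  have mono: "q i < q j" if "i \<in> {1..n}" "j \<in> {1..n}" "i < j" for i j
    using less.prems(2) that by (auto simp: strict_mono_on_def)
  show ?case
  proof (cases "\<exists>j\<in>{1..<n}. k j = 0")
    case True
    then obtain j0 where j0: "1 \<le> j0" "j0 < n" "k j0 = 0" by auto
    define m where "m = (q j0 + q (j0 + 1)) / 2"
    have "q j0 < q (j0 + 1)" using mono[of j0 "j0 + 1"] j0 by auto
    then have m: "q j0 < m" "m < q (j0 + 1)" by (auto simp: m_def)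
    have q1: "a < q i \<and> q i < m" if "i \<in> {1..j0}" for i
      using mono[of i j0] less.prems(3)[of i] m j0 that by (cases "i = j0") auto
    have q2: "m < q i \<and> q i < b" if "i \<in> {j0<..n}" for i
      using mono[of "j0 + 1" i] less.prems(3)[of i] m j0 that by (cases "i = j0 + 1") auto
    have "sum k {1..<j0} \<le> sum k {1..<n}" using j0 by (intro sum_mono2) auto
    then have "\<exists>h. realizes h a m j0 q k"
      using j0 q1 mono by (intro less.hyps) (auto simp: strict_mono_on_def)
    moreover have "sum (\<lambda>i. k (j0 + i)) {1..<n - j0} = sum k {j0 + 1..<n}"
      using sum.shift_bounds_nat_ivl[of k 1 j0 "n - j0"] j0 by (simp add: add.commute)
    then have "sum (\<lambda>i. k (j0 + i)) {1..<n - j0} \<le> sum k {1..<n}"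
      using sum_mono2[of "{1..<n}" "{j0 + 1..<n}" k] j0 by auto
    then have "\<exists>h. realizes h m b (n - j0) (\<lambda>i. q (j0 + i)) (\<lambda>i. k (j0 + i))"
      using j0 q2 mono by (intro less.hyps) (auto simp: strict_mono_on_def)
    ultimately obtain hl hr where "realizes hl a m j0 q k"
      "realizes hr m b (n - j0) (\<lambda>i. q (j0 + i)) (\<lambda>i. k (j0 + i))" by blast
    moreover have "a < m" "m < b" using q1[of j0] q2[of "j0 + 1"] m j0 by auto
    ultimately show ?thesis
      using realizes_split[of hl a m j0 q k hr b n] j0 q1 q2 m_def by blast
  next
    case False
    then have k1: "1 \<le> k j" if "j \<in> {1..<n}" for j using that by (metis less_one not_less)
    show ?thesis
    proof (cases "n = 1")
      case True
      then show ?thesis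
        using less.prems by (intro exI[of _ id]) (auto simp: realizes_def disc_homeo_id)
    next
      case n1: False
      then have n: "n \<ge> 2" using less.prems by simp
      \<comment> \<open>Half of the smaller margin at the two ends: the concentric disk shrunk by
        \<open>d\<close> still contains all punctures.\<close>
      define d where "d = min (q 1 - a) (b - q n) / 2"
      define a' where "a' = a + d"
      define b' where "b' = b - d"
      have "d > 0" "a + d < q 1" "q n < b - d"
        using less.prems(3)[of 1] less.prems(3)[of n] n by (auto simp: d_def min_def field_simps)
      moreover have "q 1 < q n" using mono[of 1 n] n by auto
      ultimately have ab: "a < a'" "a' < b'" "a' + b' = a + b" "a' < q 1" "q n < b'"
        by (auto simp: a'_def b'_def)
      have q: "a' < q i \<and> q i < b'" if "i \<in> {1..n}" for i
        using mono[of 1 i] mono[of i n] that ab by (cases "i = 1"; cases "i = n") auto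
      have "sum (\<lambda>i. k (n - i) - 1) {1..<n} < sum (\<lambda>i. k (n - i)) {1..<n}"
        using k1 n by (intro sum_strict_mono) (auto simp: Suc_le_eq)
      also have "sum (\<lambda>i. k (n - i)) {1..<n} = sum k {1..<n}"
        by (rule sum.reindex_bij_witness[of _ "\<lambda>i. n - i" "\<lambda>i. n - i"]) auto
      finally have "n + sum (\<lambda>i. k (n - i) - 1) {1..<n} < n + sum k {1..<n}" by simp
      moreover have "strict_mono_on {1..n} (\<lambda>i. a + b - q (n + 1 - i))"
        by (auto simp: strict_mono_on_def intro!: mono)
      moreover have "a' < a + b - q (n + 1 - i) \<and> a + b - q (n + 1 - i) < b'" if "i \<in> {1..n}" for i
      proof -
        have "n + 1 - i \<in> {1..n}" using that by auto
        then show ?thesis using q[of "n + 1 - i"] ab(3) by linarith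
      qed
      ultimately obtain g where "realizes g a' b' n (\<lambda>i. a + b - q (n + 1 - i)) (\<lambda>i. k (n - i) - 1)"
        using less.hyps[of n "\<lambda>i. k (n - i) - 1" "\<lambda>i. a + b - q (n + 1 - i)" a' b'] less.prems(1) by blast
      from realizes_twist[OF this ab(1-3) q k1] show ?thesis by blast
    qed
  qed
qed

section \<open>Representatives of braids and the count\<close>

lemma strict_mono_fixing_shift:
  fixes l u v b :: real
  assumes "l < u" "u < b" "l < v" "v < b"
  obtains f where "continuous_on UNIV f" "strict_mono f" "f u = v" "\<And>x. x \<le> l \<or> b \<le> x \<Longrightarrow> f x = x"
proof
  define A where "A x = l + (x - l) * ((v - l) / (u - l))" for x
  define B where "B x = v + (x - u) * ((b - v) / (b - u))" for x
  define f where "f x = (if x \<le> l then x else if x \<le> u then A x else if x \<le> b then B x else x)" for x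
  have AB: "A l = l" "A u = v" "B u = v" "B b = b" using assms by (auto simp: A_def B_def)
  have A: "A x < A y" if "x < y" for x y
    unfolding A_def using assms that by (intro add_strict_left_mono mult_strict_right_mono) auto
  have B: "B x < B y" if "x < y" for x y
    unfolding B_def using assms that by (intro add_strict_left_mono mult_strict_right_mono) auto
  show "strict_mono f"
  proof (rule strict_monoI)
    fix x y :: real assume xy: "x < y"
    show "f x < f y"
      using xy AB assms A[OF xy] B[OF xy] A[of l y] A[of x u] B[of u y] B[of x b]
      unfolding f_def by (cases "x = b"; cases "x = u"; cases "y = b"; auto split: if_splits)
  qed
  show "continuous_on UNIV f"
    unfolding f_def
    by (intro continuous_on_cases_le continuous_intros; (auto simp: A_def B_def intro!: continuous_intros)?)
      (use AB assms in \<open>auto simp: A_def B_def\<close>)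
  show "f u = v" "\<And>x. x \<le> l \<or> b \<le> x \<Longrightarrow> f x = x"
    using assms AB by (auto simp: f_def)
qed

text \<open>The points are put in place from left to right; each further correction fixes everything
  up to the last target reached, so earlier points stay where they are.\<close>

lemma strict_mono_interpolation:
  fixes p t :: "nat \<Rightarrow> real"
  assumes "strict_mono_on {1..n} p" "strict_mono_on {1..n} t" "a < b"
    "\<And>i. i \<in> {1..n} \<Longrightarrow> a < p i \<and> p i < b" "\<And>i. i \<in> {1..n} \<Longrightarrow> a < t i \<and> t i < b"
  shows "\<exists>f. continuous_on UNIV f \<and> strict_mono f \<and> (\<forall>x. x \<le> a \<or> b \<le> x \<longrightarrow> f x = x) \<and>
    (\<forall>i\<in>{1..n}. f (p i) = t i)"
  using assms
proof (induction n)
  case 0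
  then show ?case by (intro exI[of _ id]) (auto simp: strict_mono_def)
next
  case (Suc n)
  have "strict_mono_on {1..n} p" "strict_mono_on {1..n} t"
    using Suc.prems(1,2) by (auto simp: strict_mono_on_def)
  then obtain f where f: "continuous_on UNIV f" "strict_mono f" "\<And>x. x \<le> a \<or> b \<le> x \<Longrightarrow> f x = x"
    "\<And>i. i \<in> {1..n} \<Longrightarrow> f (p i) = t i"
    using Suc.IH Suc.prems by force
  define l where "l = (if n = 0 then a else t n)"
  have t_le: "t i \<le> l" if "i \<in> {1..n}" for i
    using that Suc.prems(2) by (cases "i = n") (auto simp: l_def strict_mono_on_def less_imp_le)
  have pn: "a < p (Suc n)" "p (Suc n) < b" "a < t (Suc n)" "t (Suc n) < b"
    using Suc.prems by auto
  have "a \<le> l" using Suc.prems(5)[of n] by (auto simp: l_def)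
  have "l < t (Suc n)" using Suc.prems(2) pn by (auto simp: l_def strict_mono_on_def)
  moreover have "l < f (p (Suc n))"
  proof (cases "n = 0")
    case True
    then show ?thesis using strict_monoD[OF f(2) pn(1)] f(3)[of a] by (simp add: l_def)
  next
    case False
    then have "p n < p (Suc n)" using Suc.prems(1) by (auto simp: strict_mono_on_def)
    then show ?thesis using strict_monoD[OF f(2)] f(4)[of n] False by (fastforce simp: l_def)
  qed
  moreover have "f (p (Suc n)) < b" using strict_monoD[OF f(2) pn(2)] f(3)[of b] by simp
  ultimately obtain g where g: "continuous_on UNIV g" "strict_mono g" "g (f (p (Suc n))) = t (Suc n)"
    "\<And>x. x \<le> l \<or> b \<le> x \<Longrightarrow> g x = x"
    using strict_mono_fixing_shift pn(4) by metis
  have "continuous_on UNIV (g \<circ> f)"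
    by (intro continuous_on_compose f(1) continuous_on_subset[OF g(1)]) auto
  moreover have "strict_mono (g \<circ> f)"
    using f(2) g(2) by (auto simp: strict_mono_def)
  moreover have "(g \<circ> f) x = x" if "x \<le> a \<or> b \<le> x" for x
    using that f(3)[of x] g(4)[of x] \<open>a \<le> l\<close> by auto
  moreover have "(g \<circ> f) (p i) = t i" if "i \<in> {1..Suc n}" for i
    using that f(4)[of i] g(3) g(4)[of "t i"] t_le[of i] by (cases "i = Suc n") auto
  ultimately show ?case by blast
qed

lemma diam_ball_unit [simp]: "diam_ball (-1) 1 = ball 0 1"
  by (simp add: diam_ball_def)

text \<open>On each horizontal line the extension is a convex combination of \<open>f\<close> and
  the identity, hence strictly increasing; the weight of \<open>f\<close> fades out with the
  distance from the real axis.\<close>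

lemma real_line_homeo_extension:
  assumes "continuous_on UNIV f" "strict_mono f" "\<And>x. x \<le> a \<or> b \<le> x \<Longrightarrow> f x = x"
    and ab: "-1 < a" "a < b" "b < 1"
  obtains e where "disc_homeo (-1) 1 e" "\<And>x. e (of_real x) = of_real (f x)"
proof
  \<comment> \<open>With this height, moved points satisfy
    \<open>\<bar>Re z\<bar> + \<bar>Im z\<bar> < 1\<close> and so lie in the unit disk.\<close>
  define Y where "Y = 1 - max \<bar>a\<bar> \<bar>b\<bar>"
  have "Y > 0" using ab by (auto simp: Y_def abs_if max_def)
  define \<psi> where "\<psi> z = max 0 (1 - \<bar>Im z\<bar> / Y)" for z
  define e where "e z = z + of_real ((f (Re z) - Re z) * \<psi> z)" for z
  show "e (of_real x) = of_real (f x)" for x by (simp add: e_def \<psi>_def)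
  have \<psi>: "0 \<le> \<psi> z" "\<psi> z \<le> 1" for z using \<open>Y > 0\<close> by (auto simp: \<psi>_def)
  show "disc_homeo (-1) 1 e"
    unfolding disc_homeo_def
  proof (intro conjI allI impI)
    show "continuous_on UNIV e"
      unfolding e_def \<psi>_def using \<open>Y > 0\<close>
      by (intro continuous_intros continuous_on_compose2[OF assms(1)]) auto
    show "inj e"
    proof (rule injI)
      fix z w assume eq: "e z = e w"
      have Im: "Im z = Im w" using arg_cong[OF eq, of Im] by (simp add: e_def)
      then have \<psi>_eq: "\<psi> z = \<psi> w" by (simp add: \<psi>_def)
      have Re: "(1 - \<psi> w) * Re z + \<psi> w * f (Re z) = (1 - \<psi> w) * Re w + \<psi> w * f (Re w)"
        using arg_cong[OF eq, of Re] by (simp add: e_def \<psi>_eq algebra_simps)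
      have lt: "(1 - \<psi> w) * x + \<psi> w * f x < (1 - \<psi> w) * y + \<psi> w * f y" if "x < y" for x y
      proof (cases "\<psi> w = 1")
        case False
        then have "(1 - \<psi> w) * x < (1 - \<psi> w) * y" using \<psi>[of w] that by simp
        moreover have "\<psi> w * f x \<le> \<psi> w * f y"
          using \<psi>[of w] strict_monoD[OF assms(2) that] by (intro mult_left_mono) auto
        ultimately show ?thesis by simp
      qed (use strict_monoD[OF assms(2) that] in auto)
      have "Re z = Re w" using lt[of "Re z" "Re w"] lt[of "Re w" "Re z"] Re by (cases "Re z" "Re w" rule: linorder_cases) auto
      with Im show "z = w" by (simp add: complex_eq_iff)
    qed
    show "e z = z" if "z \<notin> diam_ball (-1) 1" for z
    proof (rule ccontr)
      assume "e z \<noteq> z"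
      then have "f (Re z) \<noteq> Re z" "\<psi> z \<noteq> 0" by (auto simp: e_def)
      then have "a < Re z \<and> Re z < b" using assms(3)[of "Re z"] by force
      moreover have "\<bar>Im z\<bar> < Y"
      proof (rule ccontr)
        assume "\<not> \<bar>Im z\<bar> < Y"
        then have "1 \<le> \<bar>Im z\<bar> / Y" using \<open>Y > 0\<close> by (simp add: field_simps)
        then show False using \<open>\<psi> z \<noteq> 0\<close> by (simp add: \<psi>_def)
      qed
      ultimately have "cmod z < 1"
        using cmod_le[of z] by (auto simp: Y_def)
      then show False using that by simp
    qed
  qed
qed

lemma disc_homeo_orientation_preserving:
  assumes "disc_homeo (-1) 1 h"
  shows "orientation_preserving_homeo h"
proof -
  have cont: "continuous_on UNIV h" and inj: "inj h" using assms by (auto simp: disc_homeo_def)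
  have fix_out: "h z = z" if "cmod z \<ge> 1" for z using disc_homeo_fix[OF assms, of z] that by simp
  \<comment> \<open>The range is open by invariance of domain and closed as the union of a compact
    image and the fixed exterior, hence the whole plane.\<close>
  have "open (range h)" by (rule invariance_of_domain[OF cont]) (use inj in auto)
  moreover have "range h = h ` cball 0 1 \<union> - ball 0 1"
  proof (rule set_eqI)
    fix z
    have "z \<in> h ` cball 0 1 \<union> - ball 0 1" if "z = h w" for w
      using that fix_out[of w] by (cases "cmod w \<le> 1") auto
    moreover have "z \<in> range h" if "z \<in> - ball 0 1"
      using fix_out[of z] that by (intro range_eqI[of _ _ z]) auto
    ultimately show "z \<in> range h \<longleftrightarrow> z \<in> h ` cball 0 1 \<union> - ball 0 1" by blast
  qed
  moreover have "closed (h ` cball 0 1 \<union> - ball 0 1)"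
    by (intro closed_Un compact_imp_closed[OF compact_continuous_image] continuous_on_subset[OF cont]) auto
  ultimately have surj: "range h = UNIV"
    using clopen[of "range h"] by simp
  obtain h' where "homeomorphism UNIV (range h) h h'"
    using invariance_of_domain_homeomorphism[OF open_UNIV cont _ inj] by auto
  then have "\<exists>h'. homeomorphism UNIV UNIV h h'" using surj by metis
  moreover have "winding_number (h \<circ> circlepath z r) (h z) = 1" if "0 < r" for z r
  proof -
    txt \<open>The circle is moved to one outside the disk, where \<open>h\<close> is the identity. Injectivity of \<open>h\<close>
      keeps the image of the center off the image of the circle.\<close>
    define C where "C \<tau> = (1 - \<tau>) *\<^sub>R z + \<tau> *\<^sub>R 3" for \<tau> :: real
    define R where "R \<tau> = (1 - \<tau>) * r + \<tau>" for \<tau> :: real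
    define F where "F x = h (C (fst x) + of_real (R (fst x)) * exp (2 * of_real pi * \<i> * of_real (snd x))) - h (C (fst x))" for x
    have "homotopic_loops (- {0}) (\<lambda>t. (h \<circ> circlepath z r) t - h z) (\<lambda>t. (h \<circ> circlepath 3 1) t - h 3)"
      unfolding homotopic_loops
    proof (intro exI[of _ F] conjI ballI)
      show "continuous_on ({0..1} \<times> {0..1}) F"
        unfolding F_def C_def R_def by (intro continuous_intros continuous_on_compose2[OF cont]) auto
      have "R \<tau> \<noteq> 0" if "\<tau> \<in> {0..1}" for \<tau>
      proof (cases "\<tau> = 1")
        case False
        then have "(1 - \<tau>) * r > 0" using that \<open>0 < r\<close> by auto
        then show ?thesis using that by (auto simp: R_def)
      qed (simp add: R_def)
      then show "F \<in> ({0..1} \<times> {0..1}) \<rightarrow> - {0}"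
        by (auto simp: F_def inj_eq[OF inj])
    qed (auto simp: F_def C_def R_def circlepath pathstart_def pathfinish_def)
    then have "winding_number (\<lambda>t. (h \<circ> circlepath z r) t - h z) 0 = winding_number (\<lambda>t. (h \<circ> circlepath 3 1) t - h 3) 0"
      by (rule winding_number_homotopic_loops)
    also have "\<dots> = winding_number (\<lambda>t. circlepath 3 1 t - 3) 0"
    proof (rule winding_number_cong)
      fix t :: real
      have "dist (circlepath 3 1 t) 3 = 1" by (simp add: circlepath dist_norm)
      then have "cmod (circlepath 3 1 t) \<ge> 1"
        using norm_triangle_ineq2[of 3 "3 - circlepath 3 1 t"] by (simp add: dist_norm norm_minus_commute)
      then show "(h \<circ> circlepath 3 1) t - h 3 = circlepath 3 1 t - 3" by (simp add: fix_out)
    qed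
    also have "\<dots> = winding_number (circlepath 3 1) 3"
      by (rule winding_number_offset[symmetric])
    also have "\<dots> = 1" by (simp add: winding_number_circlepath_centre)
    finally show ?thesis by (subst winding_number_offset)
  qed
  ultimately show ?thesis by (simp add: orientation_preserving_homeo_def)
qed

section \<open>Isotopy invariance of the twist numbers\<close>

lemma pair_twist_unique:
  assumes "inj h" "pair_twist h a b u v k" "pair_twist h a b u v k'"
  shows "k = k'"
proof -
  obtain s t where s: "s < t" "{h (of_real s), h (of_real t)} = {of_real u, of_real v}"
    "2 * Re (winding_number (h \<circ> linepath (of_real a) (of_real s)) (h (of_real t))) = k"
    using assms(2) by (auto simp: pair_twist_def)
  obtain s' t' where s': "s' < t'" "{h (of_real s'), h (of_real t')} = {of_real u, of_real v}"
    "2 * Re (winding_number (h \<circ> linepath (of_real a) (of_real s')) (h (of_real t'))) = k'"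
    using assms(3) by (auto simp: pair_twist_def)
  have "{h (of_real s), h (of_real t)} = {h (of_real s'), h (of_real t')}"
    using s(2) s'(2) by simp
  then have "s = s' \<and> t = t'"
    using s(1) s'(1) by (auto simp: doubleton_eq_iff inj_eq[OF assms(1)])
  then show ?thesis using s(3) s'(3) by simp
qed

lemma H_homeosD:
  assumes "h \<in> H_homeos n p"
  shows "continuous_on S h" "inj h" "h ` puncture_set n p = puncture_set n p"
    "h ` sphere 0 1 = sphere 0 1" "h 1 = 1" "h (-1) = -1"
proof -
  obtain h' where h': "homeomorphism UNIV UNIV h h'"
    using assms by (auto simp: H_homeos_def orientation_preserving_homeo_def)
  show "continuous_on S h"
    using homeomorphism_cont1[OF h'] by (rule continuous_on_subset) simp
  show "inj h" using homeomorphism_apply1[OF h'] by (metis UNIV_I injI)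
qed (use assms in \<open>auto simp: H_homeos_def\<close>)

lemma puncture_config_bounds: "puncture_config n p \<Longrightarrow> i \<in> {1..n} \<Longrightarrow> -1 < p i \<and> p i < 1"
  by (auto simp: puncture_config_def image_subset_iff)

text \<open>Some puncture is mapped to a puncture, hence into the open disk. If \<open>h z\<close>
  lay outside, the image of a segment from that puncture to \<open>z\<close> would meet the circle,
  whose preimage is the circle alone.\<close>

lemma H_homeos_ball:
  assumes h: "h \<in> H_homeos n p" and p: "puncture_config n p" and "1 \<le> n" and z: "cmod z < 1"
  shows "cmod (h z) < 1"
proof (rule ccontr)
  assume not_less: "\<not> cmod (h z) < 1"
  note hD = H_homeosD[OF h]
  have P: "cmod w < 1" if "w \<in> puncture_set n p" for w
    using that puncture_config_bounds[OF p] by (force simp: puncture_set_def)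
  define w where "w = complex_of_real (p 1)"
  have "w \<in> puncture_set n p" using \<open>1 \<le> n\<close> by (auto simp: w_def puncture_set_def)
  then have w: "cmod w < 1" "cmod (h w) < 1" using P hD(3) by blast+
  have "continuous_on {0..1} (\<lambda>\<tau>. cmod (h (linepath w z \<tau>)))"
    by (intro continuous_intros continuous_on_compose2[OF hD(1)[of UNIV]]) auto
  then obtain \<tau> where \<tau>: "0 \<le> \<tau>" "\<tau> \<le> 1" "cmod (h (linepath w z \<tau>)) = 1"
    using IVT'[of "\<lambda>\<tau>. cmod (h (linepath w z \<tau>))" 0 1 1] w not_less
    by (auto simp: linepath_0' linepath_1')
  then have "h (linepath w z \<tau>) \<in> h ` sphere 0 1" unfolding hD(4) by simp
  then have "linepath w z \<tau> \<in> sphere 0 1" by (simp add: inj_image_mem_iff[OF hD(2)])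
  moreover have "linepath w z \<tau> \<in> ball 0 1"
    using \<tau> w z linepath_in_convex_hull[of w "ball 0 1" z \<tau>] by (simp add: convex_hull_eq[THEN iffD2])
  ultimately show False by simp
qed

text \<open>Punctures have constant images during an isotopy, because a continuous path in a finite
  set is constant. So the isotopy moves each end arc with fixed ends, and injectivity at every time
  keeps it off the image of the other puncture.\<close>

lemma isotopy_pair_twist:
  assumes iso: "(h, h') \<in> isotopy_rel n p" and tw: "pair_twist h (-1) 1 u v k"
    and uv: "of_real u \<in> puncture_set n p" "of_real v \<in> puncture_set n p"
  shows "pair_twist h' (-1) 1 u v k"
proof -
  obtain F where F: "continuous_on ({0..1::real} \<times> UNIV) F"
      "\<And>x. F (0, x) = h x" "\<And>x. F (1, x) = h' x" "\<And>\<tau>. \<tau> \<in> {0..1} \<Longrightarrow> (\<lambda>x. F (\<tau>, x)) \<in> H_homeos n p"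
    using iso prod_topology_subtopology_eu[of "{0..1::real}" "UNIV :: complex set"]
    unfolding isotopy_rel_def homotopic_with_def by auto
  have F0: "h \<in> H_homeos n p" using F(4)[of 0] by (simp add: F(2))
  note FD = H_homeosD[OF F(4)]
  have const: "F (\<tau>, x) = h x" if x: "x \<in> puncture_set n p" and \<tau>: "\<tau> \<in> {0..1}" for x \<tau>
  proof -
    have "(\<lambda>\<tau>. F (\<tau>, x)) constant_on {0..1}"
    proof (rule continuous_finite_range_constant)
      show "continuous_on {0..1} (\<lambda>\<tau>. F (\<tau>, x))"
        by (intro continuous_on_compose2[OF F(1)] continuous_intros) auto
      have "(\<lambda>\<tau>. F (\<tau>, x)) ` {0..1} \<subseteq> puncture_set n p"
        using FD(3) x by blast
      then show "finite ((\<lambda>\<tau>. F (\<tau>, x)) ` {0..1})"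
        by (rule finite_subset) (simp add: puncture_set_def)
    qed auto
    then show ?thesis using F(2)[of x] \<tau> unfolding constant_on_def
      by (metis atLeastAtMost_iff order_refl zero_le_one)
  qed
  obtain s t where st: "-1 < s" "s < t" "t < 1" and im: "{h (of_real s), h (of_real t)} = {of_real u, of_real v}"
    and w1: "2 * Re (winding_number (h \<circ> linepath (-1) (of_real s)) (h (of_real t))) = k"
    and w2: "2 * Re (winding_number (h \<circ> linepath 1 (of_real t)) (h (of_real s))) = k"
    using tw by (auto simp: pair_twist_def)
  have preim: "x \<in> puncture_set n p" if "h x \<in> puncture_set n p" for x
    using that H_homeosD(2,3)[OF F0] by (metis inj_image_mem_iff)
  have "h (of_real s) \<in> puncture_set n p" "h (of_real t) \<in> puncture_set n p"
    using im uv by (auto simp: doubleton_eq_iff)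
  then have P: "of_real s \<in> puncture_set n p" "of_real t \<in> puncture_set n p"
    by (auto intro: preim)
  have h'_eq: "h' x = h x" if "x \<in> puncture_set n p" for x
    using const[OF that, of 1] F(3)[of x] by simp
  have wn: "winding_number (h \<circ> linepath e x) (h y) = winding_number (h' \<circ> linepath e x) (h y)"
    if "x \<in> puncture_set n p" "y \<in> puncture_set n p" "y \<notin> closed_segment e x" "e \<in> {-1, 1}" for x y e
  proof (rule winding_number_homotopic_paths)
    show "homotopic_paths (- {h y}) (h \<circ> linepath e x) (h' \<circ> linepath e x)"
      unfolding homotopic_paths
    proof (intro exI[of _ "\<lambda>z. F (fst z, linepath e x (snd z))"] conjI ballI)
      show "continuous_on ({0..1} \<times> {0..1}) (\<lambda>z. F (fst z, linepath e x (snd z)))"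
        unfolding linepath_def by (intro continuous_on_compose2[OF F(1)] continuous_intros) auto
      show "(\<lambda>z. F (fst z, linepath e x (snd z))) \<in> {0..1} \<times> {0..1} \<rightarrow> - {h y}"
      proof clarsimp
        fix \<tau> r :: real assume \<tau>: "0 \<le> \<tau>" "\<tau> \<le> 1" "0 \<le> r" "r \<le> 1" and "F (\<tau>, linepath e x r) = h y"
        then have "F (\<tau>, linepath e x r) = F (\<tau>, y)" using const[of y \<tau>] that by simp
        then have "linepath e x r = y" using FD(2)[of \<tau>] \<tau> by (auto dest: injD)
        then show False using linepath_in_path[of r e x] \<tau> that by auto
      qed
      have "F (\<tau>, e) = h e" if "\<tau> \<in> {0..1}" for \<tau>
        using FD(5,6)[OF that] H_homeosD(5,6)[OF F0] \<open>e \<in> {-1, 1}\<close> by auto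
      then show "pathstart ((\<lambda>z. F (fst z, linepath e x (snd z))) \<circ> Pair \<tau>) = pathstart (h \<circ> linepath e x)"
        "pathfinish ((\<lambda>z. F (fst z, linepath e x (snd z))) \<circ> Pair \<tau>) = pathfinish (h \<circ> linepath e x)"
        if "\<tau> \<in> {0..1}" for \<tau>
        using const[of x \<tau>] that \<open>x \<in> puncture_set n p\<close>
        by (simp_all add: pathstart_def pathfinish_def linepath_0' linepath_1')
    qed (use F in auto)
  qed
  have seg: "complex_of_real t \<notin> closed_segment (-1) (of_real s)" "complex_of_real s \<notin> closed_segment 1 (of_real t)"
    using of_real_in_closed_segment[of t "-1" s] of_real_in_closed_segment[of s 1 t] st
    by (auto simp: closed_segment_eq_real_ivl)
  show ?thesis
    unfolding pair_twist_def using st im w1 w2 P seg wn[of "of_real s" "of_real t" "-1"] wn[of "of_real t" "of_real s" 1]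
    by (intro exI[of _ s] exI[of _ t]) (auto simp: h'_eq)
qed

section \<open>Bounds for the norm, and the count\<close>

lemma segment_lamination_decomposition:
  "h ` closed_segment (-1) 1 \<inter> trivial_lamination n p =
    (\<Union>j\<in>{1..<n}. (\<lambda>x. h (of_real x)) ` crossings h (-1) 1 ((p j + p (j + 1)) / 2))"
proof -
  have seg: "closed_segment (-1) 1 = complex_of_real ` {-1..1}"
    using closed_segment_of_real[of "-1" 1] by (simp add: closed_segment_eq_real_ivl)
  have "{1..n - 1} = {1..<n}" by auto
  then show ?thesis
    unfolding seg trivial_lamination_def crossings_def by auto
qed

lemma diagrammatic_lower_bound:
  assumes h: "h \<in> H_homeos n p" and p: "puncture_config n p" and "1 \<le> n"
    and tw: "\<And>j. j \<in> {1..<n} \<Longrightarrow> pair_twist h (-1) 1 (p j) (p (j + 1)) (k j)"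
  shows "enat (\<Sum>j\<in>{1..<n}. 2 * k j + 1) \<le> ecard (h ` closed_segment (-1) 1 \<inter> trivial_lamination n p)"
proof (cases "finite (h ` closed_segment (-1) 1 \<inter> trivial_lamination n p)")
  case True
  define m where "m j = (p j + p (j + 1)) / 2" for j
  define X where "X j = (\<lambda>x. h (of_real x)) ` crossings h (-1) 1 (m j)" for j
  note hD = H_homeosD[OF h]
  have dec: "h ` closed_segment (-1) 1 \<inter> trivial_lamination n p = (\<Union>j\<in>{1..<n}. X j)"
    unfolding segment_lamination_decomposition X_def m_def ..
  have pmono: "p i < p j" if "i \<in> {1..n}" "j \<in> {1..n}" "i < j" for i j
    using p that by (auto simp: puncture_config_def strict_mono_on_def)
  have inj: "inj_on (\<lambda>x. h (of_real x)) S" for S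
    by (auto simp: inj_on_def inj_eq[OF hD(2)])
  have finX: "finite (X j)" if "j \<in> {1..<n}" for j
    using finite_subset[OF _ True[unfolded dec], of "X j"] that by blast
  have mlt: "m i < m j" if "i \<in> {1..<n}" "j \<in> {1..<n}" "i < j" for i j
    using pmono[of i j] pmono[of "i + 1" "j + 1"] that by (simp add: m_def)
  have disj: "X i \<inter> X j = {}" if "i \<in> {1..<n}" "j \<in> {1..<n}" "i \<noteq> j" for i j
  proof -
    have "m i \<noteq> m j" using that mlt[of i j] mlt[of j i] by (cases i j rule: linorder_cases) auto
    then show ?thesis by (auto simp: X_def crossings_def)
  qed
  have "2 * k j + 1 \<le> card (X j)" if j: "j \<in> {1..<n}" for j
  proof -
    have "p j < p (j + 1)" using pmono[of j "j + 1"] j by auto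
    then have "p j < m j" "m j < p (j + 1)" by (auto simp: m_def)
    moreover have "finite {x\<in>{-1..1}. Re (h (of_real x)) = m j}"
      using finite_imageD[OF finX[OF j, unfolded X_def] inj] by (simp add: crossings_def)
    ultimately have "2 * k j + 1 \<le> card (crossings h (-1) 1 (m j))"
      unfolding crossings_def
      using pair_twist_crossings[OF hD(1,2) H_homeos_ball[OF h p \<open>1 \<le> n\<close>] hD(5,6) tw[OF j]] by blast
    then show ?thesis by (simp add: X_def card_image[OF inj])
  qed
  then have "(\<Sum>j\<in>{1..<n}. 2 * k j + 1) \<le> (\<Sum>j\<in>{1..<n}. card (X j))"
    by (rule sum_mono)
  also have "\<dots> = card (\<Union>j\<in>{1..<n}. X j)"
    using finX disj by (intro card_UN_disjoint[symmetric]) auto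
  finally show ?thesis using True by (simp add: ecard_def dec)
qed (simp add: ecard_def)

text \<open>The map \<open>g\<close> from \<open>realizes_exists\<close> takes certain points of the
  diameter to the punctures. Precomposing it with a homeomorphism that moves the punctures to these
  points gives an element of \<open>H_homeos\<close>. The diameter is merely reparametrized, so
  twists are unchanged and no crossings are added.\<close>

lemma twisted_representative:
  assumes p: "puncture_config n p" and n: "1 \<le> n"
  obtains h where "h \<in> H_homeos n p"
    "\<And>j. j \<in> {1..<n} \<Longrightarrow> pair_twist h (-1) 1 (p j) (p (j + 1)) (k j)"
    "ecard (h ` closed_segment (-1) 1 \<inter> trivial_lamination n p) \<le> enat (\<Sum>j\<in>{1..<n}. 2 * k j + 1)"
proof -
  note bounds = puncture_config_bounds[OF p]
  have pmono: "strict_mono_on {1..n} p" using p by (simp add: puncture_config_def)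
  have pinj: "inj_on p {1..n}" using pmono by (rule strict_mono_on_imp_inj_on)
  obtain g where g: "realizes g (-1) 1 n p k"
    using realizes_exists[OF n pmono, of "-1" 1 k] bounds by blast
  then have dg: "disc_homeo (-1) 1 g"
    and tw: "\<And>j. j \<in> {1..<n} \<Longrightarrow> pair_twist g (-1) 1 (p j) (p (j + 1)) (k j)"
    and cr: "\<And>j. j \<in> {1..<n} \<Longrightarrow> finite (crossings g (-1) 1 ((p j + p (j + 1)) / 2)) \<and>
        card (crossings g (-1) 1 ((p j + p (j + 1)) / 2)) \<le> 2 * k j + 1"
    unfolding realizes_def by blast+
  obtain x where x: "\<And>i. i \<in> {1..n} \<Longrightarrow> -1 < x i \<and> x i < 1 \<and> g (of_real (x i)) = of_real (p i)"
    using g unfolding realizes_def by metis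
  have xinj: "inj_on x {1..n}"
    using pinj x by (metis (no_types, lifting) inj_on_def of_real_eq_iff)
  \<comment> \<open>The preimages \<open>x i\<close> need not increase with \<open>i\<close>, since
    a braid permutes the punctures. A monotone map can reach only their sorted version
    \<open>y\<close>.\<close>
  define ys where "ys = sorted_list_of_set (x ` {1..n})"
  define y where "y i = ys ! (i - 1)" for i
  have len: "length ys = n" using xinj by (simp add: ys_def card_image)
  have set_ys: "set ys = x ` {1..n}" by (simp add: ys_def)
  have ysort: "sorted_wrt (<) ys" unfolding ys_def by (rule strict_sorted_list_of_set)
  have ymono: "strict_mono_on {1..n} y"
  proof (rule strict_mono_onI)
    fix i j assume "i \<in> {1..n}" "j \<in> {1..n}" "i < j"
    then have "i - 1 < j - 1" "j - 1 < length ys" using len by auto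
    then show "y i < y j" using ysort by (simp add: y_def sorted_wrt_nth_less)
  qed
  have yim: "y ` {1..n} = x ` {1..n}"
  proof -
    have "(\<lambda>i. i - 1) ` {1..n} = {..<n}"
      by (auto intro!: image_eqI[of _ _ "Suc _"])
    then have "y ` {1..n} = (!) ys ` {..<length ys}"
      unfolding y_def len by (metis image_image)
    then show ?thesis using set_ys nth_image[of "length ys" ys] by (simp add: lessThan_atLeast0)
  qed
  have ybounds: "-1 < y i \<and> y i < 1" if "i \<in> {1..n}" for i
    using x yim that by (metis (no_types, lifting) image_iff)
  \<comment> \<open>The number \<open>d\<close> defined from \<open>c\<close> lies strictly between
    all absolute values involved and 1, which leaves room to extend \<open>f\<close> within the unit
    disk.\<close>
  define c where "c = Max (insert 0 ((\<lambda>i. \<bar>p i\<bar>) ` {1..n} \<union> (\<lambda>i. \<bar>y i\<bar>) ` {1..n}))"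
  have "c < 1" unfolding c_def using bounds ybounds by (subst Max_less_iff) (auto simp: abs_less_iff)
  have c: "0 \<le> c" "\<And>i. i \<in> {1..n} \<Longrightarrow> \<bar>p i\<bar> \<le> c" "\<And>i. i \<in> {1..n} \<Longrightarrow> \<bar>y i\<bar> \<le> c"
    unfolding c_def by (rule Max_ge; auto)+
  define d where "d = (c + 1) / 2"
  have d: "c < d" "d < 1" "0 < d" using \<open>c < 1\<close> \<open>0 \<le> c\<close> by (auto simp: d_def)
  have pd: "- d < p i \<and> p i < d" "- d < y i \<and> y i < d" if "i \<in> {1..n}" for i
    using c(2)[OF that] c(3)[OF that] d by (auto simp: abs_le_iff)
  obtain f where f: "continuous_on UNIV f" "strict_mono f" "\<And>r. r \<le> - d \<or> d \<le> r \<Longrightarrow> f r = r"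
    "\<And>i. i \<in> {1..n} \<Longrightarrow> f (p i) = y i"
    using strict_mono_interpolation[OF pmono ymono, of "- d" d] pd d by fastforce
  obtain e where e: "disc_homeo (-1) 1 e" "\<And>r. e (of_real r) = of_real (f r)"
    using real_line_homeo_extension[OF f(1-2), of "- d" d] f(3) d by auto
  define h where "h = g \<circ> e"
  have dh: "disc_homeo (-1) 1 h" unfolding h_def by (rule disc_homeo_compose[OF dg e(1)])
  have h_of_real: "h (of_real r) = g (of_real (f r))" for r by (simp add: h_def e(2))
  have f1: "f 1 = 1" "f (-1) = -1" using f(3) d by auto
  have "h ` puncture_set n p = (\<lambda>r. g (of_real r)) ` f ` p ` {1..n}"
    by (simp add: puncture_set_def image_image h_of_real)
  also have "f ` p ` {1..n} = x ` {1..n}"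
    unfolding yim[symmetric] image_image by (rule image_cong) (simp_all add: f(4))
  also have "(\<lambda>r. g (of_real r)) ` x ` {1..n} = puncture_set n p"
    unfolding puncture_set_def image_image by (rule image_cong) (simp_all add: x)
  finally have hP: "h ` puncture_set n p = puncture_set n p" .
  have out: "h z = z" if "cmod z = 1" for z using disc_homeo_fix[OF dh, of z] that by simp
  then have "h ` sphere 0 1 = sphere 0 1" by (simp cong: image_cong_simp)
  then have hH: "h \<in> H_homeos n p"
    using disc_homeo_orientation_preserving[OF dh] hP out[of 1] out[of "-1"] by (simp add: H_homeos_def)
  \<comment> \<open>\<open>e\<close> carries the segment from \<open>b\<close> to \<open>r\<close>
    monotonically along the axis, within the segment from \<open>b\<close> to \<open>f r\<close>, so
    it may be replaced by the straight path.\<close>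
  have wn: "winding_number (h \<circ> linepath (of_real b) (of_real r)) w
      = winding_number (g \<circ> linepath (of_real b) (of_real (f r))) w"
    if "b \<in> {-1, 1}" "w \<notin> g ` closed_segment (of_real b) (of_real (f r))" for b r w
  proof -
    have "path_image (e \<circ> linepath (of_real b) (of_real r)) \<subseteq> closed_segment (of_real b) (of_real (f r))"
    proof
      fix z assume "z \<in> path_image (e \<circ> linepath (of_real b) (of_real r))"
      then obtain r' where "r' \<in> closed_segment b r" "z = of_real (f r')"
        by (auto simp: path_image_compose closed_segment_of_real e(2))
      moreover have "f b = b" using that f1 by auto
      ultimately show "z \<in> closed_segment (of_real b) (of_real (f r))"
        using strict_mono_less_eq[OF f(2), of b r'] strict_mono_less_eq[OF f(2), of r' r]
          strict_mono_less_eq[OF f(2), of r r'] strict_mono_less_eq[OF f(2), of r' b]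
          strict_mono_less_eq[OF f(2), of b r]
        by (auto simp: of_real_in_closed_segment closed_segment_eq_real_ivl split: if_splits)
    qed
    then have "winding_number (g \<circ> (e \<circ> linepath (of_real b) (of_real r))) w
        = winding_number (g \<circ> linepath (of_real b) (of_real (f r))) w"
      using that f1 e(2)[of b] e(2)[of r]
      by (intro winding_compose_path_in_segment disc_homeo_path[OF e(1)] disc_homeo_cont[OF dg])
        (auto simp: linepath_0' linepath_1')
    then show ?thesis by (simp add: h_def comp_assoc)
  qed
  show thesis
  proof (rule that[OF hH])
    fix j assume j: "j \<in> {1..<n}"
    obtain s t where st: "-1 < s" "s < t" "t < 1" and im: "{g (of_real s), g (of_real t)} = {of_real (p j), of_real (p (j + 1))}"
      and w1: "2 * Re (winding_number (g \<circ> linepath (of_real (-1)) (of_real s)) (g (of_real t))) = k j"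
      and w2: "2 * Re (winding_number (g \<circ> linepath (of_real 1) (of_real t)) (g (of_real s))) = k j"
      using tw[OF j] unfolding pair_twist_def by blast
    \<comment> \<open>The parameters \<open>s\<close> and \<open>t\<close> of a twist of
      \<open>g\<close> are preimages of punctures, hence of the form \<open>f (p i)\<close>; the
      corresponding punctures serve as parameters for \<open>h\<close>.\<close>
    have pre: "\<exists>i\<in>{1..n}. f (p i) = r" if "g (of_real r) \<in> {of_real (p j), of_real (p (j + 1))}" for r
    proof -
      have "g (of_real r) = g (of_real (x j)) \<or> g (of_real r) = g (of_real (x (j + 1)))"
        using that x[of j] x[of "j + 1"] j by auto
      then have "r \<in> x ` {1..n}" using j by (auto simp: disc_homeo_eq[OF dg])
      then show ?thesis unfolding yim[symmetric] using f(4) by auto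
    qed
    obtain i where i: "i \<in> {1..n}" "f (p i) = s" using pre[of s] im by blast
    obtain l where l: "l \<in> {1..n}" "f (p l) = t" using pre[of t] im by blast
    have "p i < p l" using st(2) strict_mono_less[OF f(2)] i l by metis
    moreover have "g (of_real t) \<notin> g ` closed_segment (of_real (-1)) (of_real s)"
      "g (of_real s) \<notin> g ` closed_segment (of_real 1) (of_real t)"
      using st by (intro disc_homeo_notin_segment[OF dg]; simp add: closed_segment_eq_real_ivl)+
    ultimately show "pair_twist h (-1) 1 (p j) (p (j + 1)) (k j)"
      unfolding pair_twist_def using im w1 w2 bounds[OF i(1)] bounds[OF l(1)]
      by (intro exI[of _ "p i"] exI[of _ "p l"]) (simp only: h_of_real i l wn insert_iff simp_thms)
  next
    define X where "X j = crossings g (-1) 1 ((p j + p (j + 1)) / 2)" for j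
    have seg: "closed_segment (-1) 1 = complex_of_real ` {-1..1}"
      using closed_segment_of_real[of "-1" 1] by (simp add: closed_segment_eq_real_ivl)
    have "f r \<in> {-1..1}" if "r \<in> {-1..1}" for r
      using that strict_mono_less_eq[OF f(2), of "-1" r] strict_mono_less_eq[OF f(2), of r 1] f1 by auto
    then have "h ` closed_segment (-1) 1 \<subseteq> g ` closed_segment (-1) 1"
      unfolding seg by (auto simp: h_of_real)
    then have sub: "h ` closed_segment (-1) 1 \<inter> trivial_lamination n p
        \<subseteq> (\<Union>j\<in>{1..<n}. (\<lambda>r. g (of_real r)) ` X j)"
      using segment_lamination_decomposition[of g n p] unfolding X_def by blast
    have fin: "finite (\<Union>j\<in>{1..<n}. (\<lambda>r. g (of_real r)) ` X j)"
      using cr unfolding X_def by blast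
    have "card (h ` closed_segment (-1) 1 \<inter> trivial_lamination n p)
        \<le> card (\<Union>j\<in>{1..<n}. (\<lambda>r. g (of_real r)) ` X j)"
      using fin sub by (rule card_mono)
    also have "\<dots> \<le> (\<Sum>j\<in>{1..<n}. card ((\<lambda>r. g (of_real r)) ` X j))"
      by (rule card_UN_le) simp
    also have "\<dots> \<le> (\<Sum>j\<in>{1..<n}. 2 * k j + 1)"
    proof (rule sum_mono)
      fix j assume "j \<in> {1..<n}"
      then show "card ((\<lambda>r. g (of_real r)) ` X j) \<le> 2 * k j + 1"
        using cr[of j] card_image_le[of "X j" "\<lambda>r. g (of_real r)"] unfolding X_def by linarith
    qed
    finally show "ecard (h ` closed_segment (-1) 1 \<inter> trivial_lamination n p) \<le> enat (\<Sum>j\<in>{1..<n}. 2 * k j + 1)"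
      using finite_subset[OF sub fin] by (simp add: ecard_def)
  qed
qed

lemma enat_card_le_ecard:
  assumes "inj_on f A" "finite A" "f ` A \<subseteq> B"
  shows "enat (card A) \<le> ecard B"
  using assms card_mono[of B "f ` A"] by (auto simp: ecard_def card_image)

theorem corollary5p9:
  fixes n k :: nat and p :: "nat \<Rightarrow> real"
  assumes "n \<ge> 2" and "puncture_config n p"
  shows "g_count n p k \<ge> enat ((k + n - 2) choose (n - 2))"
proof -
  define Ls where "Ls = {l :: nat list. length l = n - 1 \<and> sum_list l = k}"
  define \<kappa> where "\<kappa> l j = l ! (j - 1)" for l :: "nat list" and j
  have n: "1 \<le> n" using assms by simp
  have "\<exists>h. h \<in> H_homeos n p \<and> (\<forall>j\<in>{1..<n}. pair_twist h (-1) 1 (p j) (p (j + 1)) (\<kappa> l j)) \<and>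
      ecard (h ` closed_segment (-1) 1 \<inter> trivial_lamination n p) \<le> enat (\<Sum>j\<in>{1..<n}. 2 * \<kappa> l j + 1)" for l
    using twisted_representative[OF assms(2) n, of "\<kappa> l"] by metis
  then obtain h where hH: "\<And>l. h l \<in> H_homeos n p"
    and tw: "\<And>l j. j \<in> {1..<n} \<Longrightarrow> pair_twist (h l) (-1) 1 (p j) (p (j + 1)) (\<kappa> l j)"
    and le: "\<And>l. ecard (h l ` closed_segment (-1) 1 \<inter> trivial_lamination n p) \<le> enat (\<Sum>j\<in>{1..<n}. 2 * \<kappa> l j + 1)"
    by metis
  define \<beta> where "\<beta> l = isotopy_rel n p `` {h l}" for l
  have self: "h l \<in> \<beta> l" for l
    using equiv_class_self[OF equiv_isotopy_rel hH] by (simp add: \<beta>_def)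
  have tw_iso: "pair_twist h' (-1) 1 (p j) (p (j + 1)) (\<kappa> l j)" if "h' \<in> \<beta> l" "j \<in> {1..<n}" for h' l j
    using that tw by (intro isotopy_pair_twist[of "h l" h' n p]) (auto simp: \<beta>_def puncture_set_def)
  have \<beta>H: "h' \<in> H_homeos n p" if "h' \<in> \<beta> l" for h' l
    using that unfolding \<beta>_def isotopy_rel_def by (auto dest: homotopic_with_imp_property)
  have sum: "(\<Sum>j\<in>{1..<n}. 2 * \<kappa> l j + 1) = 2 * k + n - 1" if "l \<in> Ls" for l
  proof -
    have "(\<Sum>j\<in>{1..<n}. \<kappa> l j) = (\<Sum>j<n - 1. l ! j)"
      by (rule sum.reindex_bij_witness[of _ "\<lambda>i. i + 1" "\<lambda>i. i - 1"]) (auto simp: \<kappa>_def)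
    also have "\<dots> = k" using that by (auto simp: Ls_def sum_list_sum_nth lessThan_atLeast0)
    finally show ?thesis
      using n by (simp only: sum.distrib sum_distrib_left[symmetric]) simp
  qed
  have norm: "diagrammatic_norm n p (\<beta> l) = enat (2 * k + n - 1)" if "l \<in> Ls" for l
    unfolding diagrammatic_norm_def
  proof (rule antisym)
    show "(INF h\<in>\<beta> l. ecard (h ` closed_segment (-1) 1 \<inter> trivial_lamination n p)) \<le> enat (2 * k + n - 1)"
      using INF_lower[OF self] le[of l] unfolding sum[OF that] by (rule order_trans)
    show "enat (2 * k + n - 1) \<le> (INF h\<in>\<beta> l. ecard (h ` closed_segment (-1) 1 \<inter> trivial_lamination n p))"
    proof (rule INF_greatest)
      fix h' assume h': "h' \<in> \<beta> l"
      show "enat (2 * k + n - 1) \<le> ecard (h' ` closed_segment (-1) 1 \<inter> trivial_lamination n p)"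
        using diagrammatic_lower_bound[OF \<beta>H[OF h'] assms(2) n tw_iso[OF h']] sum[OF that] by simp
    qed
  qed
  \<comment> \<open>If two classes coincide, the representative \<open>h l\<close> has the twist
    numbers of both lists.\<close>
  have "inj_on \<beta> Ls"
  proof (rule inj_onI)
    fix l l' assume l: "l \<in> Ls" "l' \<in> Ls" and eq: "\<beta> l = \<beta> l'"
    have "l ! i = l' ! i" if "i < n - 1" for i
    proof -
      have j: "i + 1 \<in> {1..<n}" using that by auto
      have "\<kappa> l (i + 1) = \<kappa> l' (i + 1)"
        using pair_twist_unique[OF H_homeosD(2)[OF hH] tw[OF j, of l]] tw_iso[OF _ j, of "h l" l'] self[of l] eq
        by simp
      then show ?thesis by (simp add: \<kappa>_def)
    qed
    then show "l = l'" using l by (intro nth_equalityI) (auto simp: Ls_def)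
  qed
  moreover have card: "card Ls = (k + n - 2) choose (n - 2)"
  proof -
    have "card Ls = (k + (n - 1) - 1) choose k" unfolding Ls_def by (rule card_length_sum_list)
    also have "k + (n - 1) - 1 = k + n - 2" using assms by simp
    also have "(k + n - 2) choose k = (k + n - 2) choose (n - 2)"
      using binomial_symmetric[of k "k + n - 2"] assms by simp
    finally show ?thesis .
  qed
  \<comment> \<open>An infinite set would have \<open>card\<close> 0, so positivity of the binomial
    coefficient yields finiteness.\<close>
  moreover have "0 < card Ls" unfolding card using assms by (simp add: zero_less_binomial_iff)
  then have "finite Ls" by (rule card_ge_0_finite)
  moreover have "\<beta> ` Ls \<subseteq> {\<beta> \<in> braids n p. diagrammatic_norm n p \<beta> = enat (2 * k + n - 1)}"
    using norm hH by (auto simp: braids_def \<beta>_def quotientI)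
  ultimately show ?thesis
    unfolding g_count_def card[symmetric] by (intro enat_card_le_ecard)
qed

end
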